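(* The following bounds hold as $n\to\infty$: $$\mathrm{sat}(n,\mathcal{M}(K^6))\le \frac{23}{14}n+O(1),\qquad \mathrm{sat}(n,\mathcal{M}(K^7))\le \frac{19}{12}n+O(1),\qquad \mathrm{sat}(n,\mathcal{M}(K^8))\le \frac{14}{9}n+O(1).$$
   Context: All graphs are finite and simple. $K^r$ denotes the complete graph on $r$ vertices. For a family $\mathcal{F}$ of graphs, a graph $G$ is $\mathcal{F}$-saturated if $G$ contains no member of $\mathcal{F}$ as a subgraph, but $G+e$ does for every edge $e$ not in $G$. The saturation number $\mathrm{sat}(n,\mathcal{F})$ is the minimum number of edges in an $n$-vertex $\mathcal{F}$-saturated graph. For a graph $H$, $\mathcal{M}(H)$ denotes the class of graphs containing $H$ as a minor. *)

theory Defs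
  imports Complex_Main "HOL-Library.Landau_Symbols"
begin

record 'a graph =
  verts :: "'a set"
  edges :: "'a set set"

text \<open>Finite simple graphs: an edge is a two-element set of vertices.\<close>

definition simple_graph :: "'a graph \<Rightarrow> bool" where
  "simple_graph G \<longleftrightarrow>
     finite (verts G) \<and> (\<forall>e\<in>edges G. e \<subseteq> verts G \<and> card e = 2)"

definition add_edge :: "'a graph \<Rightarrow> 'a set \<Rightarrow> 'a graph" where
  "add_edge G e = \<lparr>verts = verts G, edges = insert e (edges G)\<rparr>"

definition complete_graph :: "nat \<Rightarrow> nat graph" where
  "complete_graph r = \<lparr>verts = {..<r}, edges = {e. e \<subseteq> {..<r} \<and> card e = 2}\<rparr>"

text \<open>Containment as a subgraph is up to isomorphism (not necessarily induced).\<close>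

definition contains_subgraph :: "'a graph \<Rightarrow> 'b graph \<Rightarrow> bool" where
  "contains_subgraph G F \<longleftrightarrow>
     (\<exists>f. inj_on f (verts F) \<and> f ` verts F \<subseteq> verts G \<and> (\<forall>e\<in>edges F. f ` e \<in> edges G))"

text \<open>\<open>connected_in G S\<close>: the subgraph of \<open>G\<close> induced by \<open>S\<close> is nonempty and connected.\<close>

definition connected_in :: "'a graph \<Rightarrow> 'a set \<Rightarrow> bool" where
  "connected_in G S \<longleftrightarrow> S \<noteq> {} \<and> S \<subseteq> verts G \<and>
     (\<forall>u\<in>S. \<forall>v\<in>S. (u, v) \<in> {(a, b). a \<in> S \<and> b \<in> S \<and> {a, b} \<in> edges G}\<^sup>*)"

text \<open>
  \<open>H\<close> is a minor of \<open>G\<close>: contracting the pairwise disjoint connected branch sets \<open>B x\<close>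
  and deleting the superfluous vertices and edges turns \<open>G\<close> into \<open>H\<close>.
\<close>

definition has_minor :: "'a graph \<Rightarrow> 'b graph \<Rightarrow> bool" where
  "has_minor G H \<longleftrightarrow>
     (\<exists>B. (\<forall>x\<in>verts H. connected_in G (B x)) \<and>
          (\<forall>x\<in>verts H. \<forall>y\<in>verts H. x \<noteq> y \<longrightarrow> B x \<inter> B y = {}) \<and>
          (\<forall>x\<in>verts H. \<forall>y\<in>verts H. {x, y} \<in> edges H \<longrightarrow>
             (\<exists>u\<in>B x. \<exists>v\<in>B y. {u, v} \<in> edges G)))"

text \<open>
  Vertices are natural numbers from here on; every finite graph is isomorphic to such a graph,
  so this only picks representatives.
\<close>

definition minor_class :: "'a graph \<Rightarrow> nat graph set" where
  "minor_class H = {G. simple_graph G \<and> has_minor G H}"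

definition saturated :: "nat graph set \<Rightarrow> nat graph \<Rightarrow> bool" where
  "saturated \<F> G \<longleftrightarrow> simple_graph G \<and>
     (\<forall>F\<in>\<F>. \<not> contains_subgraph G F) \<and>
     (\<forall>e. e \<subseteq> verts G \<and> card e = 2 \<and> e \<notin> edges G \<longrightarrow>
        (\<exists>F\<in>\<F>. contains_subgraph (add_edge G e) F))"

text \<open>
  The least number of edges. If there were no \<open>\<F>\<close>-saturated graph on \<open>n\<close> vertices, the value
  would be unspecified (not \<open>0\<close>).
\<close>

definition sat :: "nat \<Rightarrow> nat graph set \<Rightarrow> nat" where
  "sat n \<F> =
     (LEAST m. \<exists>G. saturated \<F> G \<and> card (verts G) = n \<and> card (edges G) = m)"

end

theory Submission imports Defs
begin

text \<open>
  The generalized Petersen graphs \<open>GP(8,3)\<close>, \<open>GP(13,5)\<close> and \<open>GP(19,7)\<close> are cubic on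
  \<open>r (r - 3) - 2\<close> vertices for \<open>r = 6, 7, 8\<close>. Two vertices too few for a \<open>K\<^sup>r\<close> minor, they
  nevertheless acquire one as soon as any edge is added. Gluing copies of such a graph \<open>H\<close> along a
  common edge keeps both properties: the absence of a \<open>K\<^sup>r\<close> minor because this is a clique sum, and
  saturation because an edge between two copies can be contracted to a nonedge of one copy. Each copy
  costs \<open>|E(H)| - 1\<close> edges for \<open>|V(H)| - 2\<close> vertices, which gives the slopes \<open>23/14\<close>,
  \<open>38/24\<close> and \<open>56/36\<close>. The boundedly many vertices still missing for a prescribed \<open>n\<close> are
  added one by one, each with at most \<open>r\<close> edges.
\<close>

section \<open>Minors\<close>

text \<open>The order \<open>r (r - 3) - 2\<close> comes from an exact count. Without an added edge,
  each of the \<open>r\<close> branch sets in a cubic graph needs at least \<open>r - 3\<close>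
  vertices. Since \<open>r (r - 3)\<close> is even, like the order of any cubic graph,
  \<open>r (r - 3) - 2\<close> is the largest order that this excludes. An added edge gives one more
  outgoing edge to each of the two branch sets containing its ends, so these get by with
  \<open>r - 4\<close> vertices, and the total is exactly \<open>r (r - 3) - 2\<close>. Such a minor
  has no slack: every vertex is used, each branch set induces a tree, and any two are joined by a
  single edge. All certificates below have this shape, the two smaller sets standing first. Blocks
  share an edge rather than a vertex because of neighbours: if \<open>u\<close> is adjacent to a
  shared vertex \<open>x\<close>, contracting the other block onto \<open>x\<close> only yields the
  edge \<open>ux\<close> that is already there. If an edge \<open>xy\<close> in no triangle is
  shared, \<open>u\<close> misses \<open>x\<close> or \<open>y\<close>, and the other block is
  contracted onto that end while the remaining end is kept apart.\<close>

abbreviation links :: "'a graph \<Rightarrow> 'a set \<Rightarrow> 'a rel" where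
  "links G S \<equiv> {(a, b). a \<in> S \<and> b \<in> S \<and> {a, b} \<in> edges G}"

lemma links_rtrancl_sym: "(a, b) \<in> (links G S)\<^sup>* \<Longrightarrow> (b, a) \<in> (links G S)\<^sup>*"
  by (rule symD[OF sym_rtrancl]) (auto simp: sym_def insert_commute)

lemma links_rtrancl_mono:
  assumes "(a, b) \<in> (links G S)\<^sup>*" "S \<subseteq> T" "edges G \<subseteq> edges G'"
  shows "(a, b) \<in> (links G' T)\<^sup>*"
  by (rule subsetD[OF rtrancl_mono assms(1)]) (use assms in auto)

lemma connected_inI:
  assumes "y \<in> S" "S \<subseteq> verts G" "\<And>v. v \<in> S \<Longrightarrow> (y, v) \<in> (links G S)\<^sup>*"
  shows "connected_in G S"
  unfolding connected_in_def
proof (intro conjI ballI)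
  fix u v assume "u \<in> S" "v \<in> S"
  then show "(u, v) \<in> (links G S)\<^sup>*"
    using rtrancl_trans[OF links_rtrancl_sym[OF assms(3)] assms(3)] by blast
qed (use assms in auto)

lemma connected_inD:
  "connected_in G S \<Longrightarrow> u \<in> S \<Longrightarrow> v \<in> S \<Longrightarrow> (u, v) \<in> (links G S)\<^sup>*"
  by (auto simp: connected_in_def)

lemma connected_in_image:
  assumes "connected_in G S" "f ` verts G \<subseteq> verts G'" "\<forall>e\<in>edges G. f ` e \<in> edges G'"
  shows "connected_in G' (f ` S)"
proof -
  have "(f a, f b) \<in> (links G' (f ` S))\<^sup>*" if "(a, b) \<in> (links G S)\<^sup>*" for a b
    using that
  proof induction
    case (step b c)
    then have "{f b, f c} \<in> edges G'"
      using assms(3) by fastforce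
    then have "(f b, f c) \<in> links G' (f ` S)"
      using step by auto
    with step show ?case
      by (meson rtrancl.rtrancl_into_rtrancl)
  qed simp
  then have "(f a, f b) \<in> (links G' (f ` S))\<^sup>*" if "a \<in> S" "b \<in> S" for a b
    using connected_inD[OF assms(1)] that by simp
  moreover have "S \<noteq> {}" "S \<subseteq> verts G"
    using assms(1) by (simp_all add: connected_in_def)
  ultimately show ?thesis
    unfolding connected_in_def using assms(2) by (intro conjI ballI; blast)
qed

lemma connected_in_mono:
  assumes "connected_in G S" "verts G \<subseteq> verts G'" "edges G \<subseteq> edges G'"
  shows "connected_in G' S"
  using connected_in_image[of G S id G'] assms by auto

text \<open>One tool for several transports: the identity gives monotonicity, an inverse map undoes
  a relabelling, and an automorphism of \<open>gp p k\<close> moves one added edge to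
  another.\<close>

lemma has_minor_embed:
  assumes "has_minor G H" "inj_on f (verts G)" "f ` verts G \<subseteq> verts G'"
    "\<forall>e\<in>edges G. f ` e \<in> edges G'"
  shows "has_minor G' H"
proof -
  obtain B where B: "\<forall>x\<in>verts H. connected_in G (B x)"
    "\<forall>x\<in>verts H. \<forall>y\<in>verts H. x \<noteq> y \<longrightarrow> B x \<inter> B y = {}"
    "\<forall>x\<in>verts H. \<forall>y\<in>verts H. {x, y} \<in> edges H \<longrightarrow> (\<exists>u\<in>B x. \<exists>v\<in>B y. {u, v} \<in> edges G)"
    using assms(1) unfolding has_minor_def by (elim exE conjE) (rule that)
  have sub: "B x \<subseteq> verts G" if "x \<in> verts H" for x
    using B(1) that by (auto simp: connected_in_def)
  show ?thesis
    unfolding has_minor_def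
  proof (intro exI[of _ "\<lambda>x. f ` B x"] conjI ballI impI)
    fix x y assume xy: "x \<in> verts H" "y \<in> verts H"
    show "f ` B x \<inter> f ` B y = {}" if "x \<noteq> y"
      using inj_on_image_Int[OF assms(2) sub[OF xy(1)] sub[OF xy(2)]] B(2) xy that by auto
    show "\<exists>u\<in>f ` B x. \<exists>v\<in>f ` B y. {u, v} \<in> edges G'" if xy': "{x, y} \<in> edges H"
    proof -
      obtain u v where "u \<in> B x" "v \<in> B y" "{u, v} \<in> edges G"
        using B(3) xy xy' by blast
      then show ?thesis
        using assms(4) by fastforce
    qed
  next
    fix x assume "x \<in> verts H"
    then show "connected_in G' (f ` B x)"
      using connected_in_image[OF _ assms(3,4)] B(1) by simp
  qed
qed

lemma has_minor_mono:
  assumes "has_minor G H" "verts G \<subseteq> verts G'" "edges G \<subseteq> edges G'"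
  shows "has_minor G' H"
  by (rule has_minor_embed[OF assms(1), of id]) (use assms in auto)

lemma has_complete_minor_iff:
  "has_minor G (complete_graph r) \<longleftrightarrow>
     (\<exists>B. (\<forall>x<r. connected_in G (B x)) \<and> (\<forall>x<r. \<forall>y<r. x \<noteq> y \<longrightarrow> B x \<inter> B y = {}) \<and>
          (\<forall>x<r. \<forall>y<r. x \<noteq> y \<longrightarrow> (\<exists>u\<in>B x. \<exists>v\<in>B y. {u, v} \<in> edges G)))"
proof -
  have "card {x, y} = 2 \<longleftrightarrow> x \<noteq> y" for x y :: nat
    by auto
  then show ?thesis
    unfolding has_minor_def complete_graph_def by (simp add: Ball_def)
qed

lemma not_complete_minor_if_card_less:
  assumes "finite (verts G)" "card (verts G) < r"
  shows "\<not> has_minor G (complete_graph r)"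
proof
  assume "has_minor G (complete_graph r)"
  then obtain B where B: "\<forall>x<r. connected_in G (B x)"
    "\<forall>x<r. \<forall>y<r. x \<noteq> y \<longrightarrow> B x \<inter> B y = {}"
    unfolding has_complete_minor_iff by (elim exE conjE) (rule that)
  define f where "f x = (SOME v. v \<in> B x)" for x
  have f: "f x \<in> B x" if "x < r" for x
    using B(1) that unfolding f_def connected_in_def by (metis ex_in_conv someI_ex)
  have "inj_on f {..<r}"
    using B(2) f by (fastforce simp: inj_on_def)
  moreover have "f ` {..<r} \<subseteq> verts G"
    using B(1) f by (fastforce simp: connected_in_def)
  ultimately have "card {..<r} \<le> card (verts G)"
    using assms(1) card_inj_on_le by blast
  with assms(2) show False by simp
qed

lemma complete_minor_if_clique:
  assumes "A \<subseteq> verts G" "finite A" "r \<le> card A"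
    "\<And>u v. u \<in> A \<Longrightarrow> v \<in> A \<Longrightarrow> u \<noteq> v \<Longrightarrow> {u, v} \<in> edges G"
  shows "has_minor G (complete_graph r)"
proof -
  obtain f where f: "inj_on f {..<r}" "f ` {..<r} \<subseteq> A"
    by (metis assms(2,3) card_le_inj card_lessThan finite_lessThan)
  show ?thesis
    unfolding has_complete_minor_iff
  proof (intro exI[of _ "\<lambda>x. {f x}"] conjI allI impI)
    fix x y assume "x < r" "y < r" "x \<noteq> y"
    then have "f x \<in> A" "f y \<in> A" "f x \<noteq> f y"
      using f by (auto simp: inj_on_def)
    then show "{f x} \<inter> {f y} = {}" "\<exists>u\<in>{f x}. \<exists>v\<in>{f y}. {u, v} \<in> edges G"
      using assms(4) by auto
  qed (use f assms(1) in \<open>auto simp: connected_in_def\<close>)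
qed

text \<open>The branch set containing \<open>y\<close> absorbs \<open>C\<close>, which makes up for the missing edge \<open>{u, y}\<close>.\<close>

lemma has_minor_contract:
  assumes minor: "has_minor (add_edge G {u, y}) H"
    and sub: "verts G \<subseteq> verts G'" "edges G \<subseteq> edges G'"
    and C: "C \<inter> verts G = {}" "connected_in G' (insert y C)" "c \<in> C" "{u, c} \<in> edges G'"
  shows "has_minor G' H"
proof -
  obtain B where B: "\<forall>x\<in>verts H. connected_in (add_edge G {u, y}) (B x)"
    "\<forall>x\<in>verts H. \<forall>y\<in>verts H. x \<noteq> y \<longrightarrow> B x \<inter> B y = {}"
    "\<forall>x\<in>verts H. \<forall>z\<in>verts H. {x, z} \<in> edges H \<longrightarrow>
       (\<exists>a\<in>B x. \<exists>b\<in>B z. {a, b} \<in> edges (add_edge G {u, y}))"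
    using minor unfolding has_minor_def by (elim exE conjE) (rule that)
  define B' where "B' x = (if y \<in> B x then B x \<union> C else B x)" for x
  have BV: "B x \<subseteq> verts G" if "x \<in> verts H" for x
    using B(1) that by (auto simp: connected_in_def add_edge_def)
  have CV: "C \<subseteq> verts G'"
    using C(2) by (auto simp: connected_in_def)
  have conn: "connected_in G' (B' x)" if x: "x \<in> verts H" for x
  proof -
    have cx: "connected_in (add_edge G {u, y}) (B x)"
      using B(1) x by blast
    show ?thesis
    proof (cases "y \<in> B x")
      case False
      then have "links (add_edge G {u, y}) (B x) \<subseteq> links G' (B x)"
        using sub by (auto simp: add_edge_def doubleton_eq_iff)
      then have "(a, b) \<in> (links G' (B x))\<^sup>*" if "a \<in> B x" "b \<in> B x" for a b
        by (rule subsetD[OF rtrancl_mono]) (rule connected_inD[OF cx that])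
      then show ?thesis
        using cx False BV[OF x] sub(1) by (auto simp: connected_in_def B'_def)
    next
      case True
      let ?S = "B x \<union> C"
      have y_C: "(y, w) \<in> (links G' ?S)\<^sup>*" if "w \<in> C" for w
        by (rule links_rtrancl_mono[OF connected_inD[OF C(2)]]) (use that True in auto)
      \<comment> \<open>If both ends lie in \<open>B x\<close>, the added edge may be needed to
        connect this branch set; the detour through \<open>c\<close> and \<open>C\<close> replaces
        it.\<close>
      have uy: "(u, y) \<in> (links G' ?S)\<^sup>*" if "u \<in> B x"
      proof -
        have "(u, c) \<in> links G' ?S"
          using that C by auto
        then show ?thesis
          by (rule converse_rtrancl_into_rtrancl[OF _ links_rtrancl_sym[OF y_C[OF C(3)]]])
      qed
      have link: "(a, b) \<in> (links G' ?S)\<^sup>*" if ab: "(a, b) \<in> links (add_edge G {u, y}) (B x)" for a b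
      proof (cases "{a, b} \<in> edges G")
        case True
        then have "(a, b) \<in> links G' ?S"
          using ab sub by auto
        then show ?thesis by blast
      next
        case False
        then have "{a, b} = {u, y}"
          using ab by (auto simp: add_edge_def)
        then show ?thesis
          using ab uy links_rtrancl_sym[OF uy] by (auto simp: doubleton_eq_iff)
      qed
      have "(a, b) \<in> (links G' ?S)\<^sup>*" if "(a, b) \<in> (links (add_edge G {u, y}) (B x))\<^sup>*" for a b
        using that by induction (use link in \<open>auto intro: rtrancl_trans\<close>)
      then have "connected_in G' ?S"
        using y_C connected_inD[OF cx True] BV[OF x] CV sub(1) True
        by (intro connected_inI[of y]) auto
      then show ?thesis
        using True by (simp add: B'_def)
    qed
  qed
  show ?thesis
    unfolding has_minor_def
  proof (intro exI[of _ B'] conjI ballI impI)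
    fix x z assume xz: "x \<in> verts H" "z \<in> verts H"
    show "B' x \<inter> B' z = {}" if "x \<noteq> z"
      using B(2) xz that BV[OF xz(1)] BV[OF xz(2)] C(1) unfolding B'_def by (auto split: if_splits)
    show "\<exists>a\<in>B' x. \<exists>b\<in>B' z. {a, b} \<in> edges G'" if xz': "{x, z} \<in> edges H"
    proof -
      obtain a b where ab: "a \<in> B x" "b \<in> B z" "{a, b} \<in> edges (add_edge G {u, y})"
        using B(3) xz xz' by blast
      then consider "{a, b} \<in> edges G" | "a = u" "b = y" | "a = y" "b = u"
        by (auto simp: add_edge_def doubleton_eq_iff)
      then show ?thesis
      proof cases
        case 1
        then show ?thesis using ab sub(2) unfolding B'_def by auto
      next
        case 2
        then have "u \<in> B' x" "c \<in> B' z"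
          using ab C(3) by (auto simp: B'_def)
        then show ?thesis using C(4) by blast
      next
        case 3
        then have "u \<in> B' z" "c \<in> B' x"
          using ab C(3) by (auto simp: B'_def)
        then show ?thesis using C(4) by (metis insert_commute)
      qed
    qed
  qed (rule conn)
qed

section \<open>Clique sums\<close>

definition graph_union :: "'a graph \<Rightarrow> 'a graph \<Rightarrow> 'a graph" where
  "graph_union G G' = \<lparr>verts = verts G \<union> verts G', edges = edges G \<union> edges G'\<rparr>"

lemma graph_union_simps [simp]:
  "verts (graph_union G G') = verts G \<union> verts G'"
  "edges (graph_union G G') = edges G \<union> edges G'"
  by (simp_all add: graph_union_def)

lemma graph_union_commute: "graph_union G G' = graph_union G' G"
  by (simp add: graph_union_def Un_commute)

lemma simple_graph_union:
  "simple_graph G \<Longrightarrow> simple_graph G' \<Longrightarrow> simple_graph (graph_union G G')"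
  by (auto simp: simple_graph_def)

lemma simple_graph_edgeD:
  assumes "simple_graph G" "{a, b} \<in> edges G"
  shows "a \<in> verts G" "b \<in> verts G" "a \<noteq> b"
  using assms by (fastforce simp: simple_graph_def)+

text \<open>A walk can leave and re-enter \<open>G\<close> only through the overlap. The clique edge
  between the two overlap vertices shortcuts the excursion, so the trace of \<open>S\<close> on
  \<open>G\<close> stays connected.\<close>

lemma connected_in_clique_sum:
  assumes G: "simple_graph G" "simple_graph G'"
    and clique: "\<And>u v. u \<in> verts G \<inter> verts G' \<Longrightarrow> v \<in> verts G \<inter> verts G' \<Longrightarrow> u \<noteq> v \<Longrightarrow> {u, v} \<in> edges G"
    and S: "connected_in (graph_union G G') S" "S \<inter> verts G \<noteq> {}"
  shows "connected_in G (S \<inter> verts G)"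
    and "S \<inter> (verts G' - verts G) \<noteq> {} \<Longrightarrow> S \<inter> (verts G \<inter> verts G') \<noteq> {}"
proof -
  obtain a where a: "a \<in> S" "a \<in> verts G"
    using S(2) by blast
  let ?R = "links G (S \<inter> verts G)"
  \<comment> \<open>Invariant of a walk from \<open>a\<close>: while it is outside \<open>G\<close>,
    only some overlap vertex \<open>c\<close> already reached within \<open>G\<close> is remembered.
    On re-entry a clique edge leads from \<open>c\<close> to the new position.\<close>
  have reach: "(b \<in> verts G \<and> (a, b) \<in> ?R\<^sup>*) \<or>
      (b \<in> verts G' - verts G \<and> (\<exists>c\<in>S \<inter> (verts G \<inter> verts G'). (a, c) \<in> ?R\<^sup>*))"
    if "(a, b) \<in> (links (graph_union G G') S)\<^sup>*" for b
    using that
  proof induction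
    case base
    then show ?case using a by simp
  next
    case (step b b')
    then have S': "b \<in> S" "b' \<in> S" and "{b, b'} \<in> edges G \<or> {b, b'} \<in> edges G'"
      by auto
    then consider "{b, b'} \<in> edges G" | "{b, b'} \<in> edges G'" "b \<in> verts G'" "b' \<in> verts G'"
      using simple_graph_edgeD[OF G(2)] by blast
    then show ?case
    proof cases
      case 1
      then have "b \<in> verts G" "b' \<in> verts G"
        using simple_graph_edgeD[OF G(1)] by blast+
      moreover from this have "(b, b') \<in> ?R"
        using 1 S' by auto
      ultimately show ?thesis
        using step.IH by (meson DiffD2 rtrancl.rtrancl_into_rtrancl)
    next
      case 2
      have c: "\<exists>c\<in>S \<inter> (verts G \<inter> verts G'). (a, c) \<in> ?R\<^sup>*"
        using step.IH S' 2 by blast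
      show ?thesis
      proof (cases "b' \<in> verts G")
        case True
        obtain c where c: "c \<in> S \<inter> (verts G \<inter> verts G')" "(a, c) \<in> ?R\<^sup>*"
          using c by blast
        have "c = b' \<or> (c, b') \<in> ?R"
          using clique[of c b'] c True 2 S' by auto
        then show ?thesis
          using c True by (meson rtrancl.rtrancl_into_rtrancl)
      next
        case False
        then show ?thesis using 2 c by blast
      qed
    qed
  qed
  have "S \<subseteq> verts G \<union> verts G'"
    using S(1) by (auto simp: connected_in_def)
  show "connected_in G (S \<inter> verts G)"
    by (rule connected_inI[of a]) (use a reach connected_inD[OF S(1) a(1)] in auto)
  show "S \<inter> (verts G \<inter> verts G') \<noteq> {}" if "S \<inter> (verts G' - verts G) \<noteq> {}"
    using that reach connected_inD[OF S(1) a(1)] by blast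
qed

text \<open>The traces on \<open>G\<close> serve as branch sets. An adjacency realised only in
  \<open>G'\<close> forces both branch sets to meet the overlap, where the clique supplies an edge
  of \<open>G\<close>.\<close>

lemma complete_minor_of_clique_sum_side:
  assumes G: "simple_graph G" "simple_graph G'"
    and clique: "\<And>u v. u \<in> verts G \<inter> verts G' \<Longrightarrow> v \<in> verts G \<inter> verts G' \<Longrightarrow> u \<noteq> v \<Longrightarrow> {u, v} \<in> edges G"
    and B: "\<forall>x<r. connected_in (graph_union G G') (B x)"
      "\<forall>x<r. \<forall>y<r. x \<noteq> y \<longrightarrow> B x \<inter> B y = {}"
      "\<forall>x<r. \<forall>y<r. x \<noteq> y \<longrightarrow> (\<exists>u\<in>B x. \<exists>v\<in>B y. {u, v} \<in> edges (graph_union G G'))"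
    and meet: "\<forall>x<r. B x \<inter> verts G \<noteq> {}"
  shows "has_minor G (complete_graph r)"
  unfolding has_complete_minor_iff
proof (intro exI[of _ "\<lambda>x. B x \<inter> verts G"] conjI allI impI)
  have meet': "B x \<inter> (verts G \<inter> verts G') \<noteq> {}" if "x < r" "B x \<inter> verts G' \<noteq> {}" for x
  proof (cases "B x \<inter> (verts G' - verts G) = {}")
    case True
    then show ?thesis using that(2) by blast
  next
    case False
    then show ?thesis
      using connected_in_clique_sum(2)[OF G clique, of "B x"] B(1) meet that(1) by simp
  qed
  fix x y assume xy: "x < r" "y < r" "x \<noteq> y"
  then show "B x \<inter> verts G \<inter> (B y \<inter> verts G) = {}"
    using B(2) by blast
  obtain u v where uv: "u \<in> B x" "v \<in> B y" "{u, v} \<in> edges G \<or> {u, v} \<in> edges G'"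
    using B(3) xy unfolding graph_union_simps Un_iff by blast
  show "\<exists>u\<in>B x \<inter> verts G. \<exists>v\<in>B y \<inter> verts G. {u, v} \<in> edges G"
  proof (cases "{u, v} \<in> edges G")
    case True
    then show ?thesis
      using uv simple_graph_edgeD[OF G(1) True] by blast
  next
    case False
    then have "u \<in> verts G'" "v \<in> verts G'"
      using uv simple_graph_edgeD[OF G(2)] by blast+
    then have "B x \<inter> (verts G \<inter> verts G') \<noteq> {}" "B y \<inter> (verts G \<inter> verts G') \<noteq> {}"
      using uv meet'[OF xy(1)] meet'[OF xy(2)] by blast+
    then obtain a b where "a \<in> B x" "b \<in> B y" "a \<in> verts G \<inter> verts G'" "b \<in> verts G \<inter> verts G'"
      by blast
    moreover have "a \<noteq> b"
      using calculation B(2) xy by blast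
    ultimately show ?thesis
      using clique by blast
  qed
next
  fix x assume "x < r"
  then show "connected_in G (B x \<inter> verts G)"
    using connected_in_clique_sum(1)[OF G clique] B(1) meet by simp
qed

text \<open>If neither side inherits the minor, one branch set avoids \<open>G\<close> and another
  avoids \<open>G'\<close>; no edge of the union can join these two.\<close>

lemma not_complete_minor_clique_sum:
  assumes G: "simple_graph G" "simple_graph G'"
    and clique: "\<And>u v. u \<in> verts G \<inter> verts G' \<Longrightarrow> v \<in> verts G \<inter> verts G' \<Longrightarrow> u \<noteq> v \<Longrightarrow>
      {u, v} \<in> edges G \<inter> edges G'"
    and no_minor: "\<not> has_minor G (complete_graph r)" "\<not> has_minor G' (complete_graph r)"
  shows "\<not> has_minor (graph_union G G') (complete_graph r)"
proof
  assume "has_minor (graph_union G G') (complete_graph r)"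
  then obtain B where B: "\<forall>x<r. connected_in (graph_union G G') (B x)"
    "\<forall>x<r. \<forall>y<r. x \<noteq> y \<longrightarrow> B x \<inter> B y = {}"
    "\<forall>x<r. \<forall>y<r. x \<noteq> y \<longrightarrow> (\<exists>u\<in>B x. \<exists>v\<in>B y. {u, v} \<in> edges (graph_union G G'))"
    unfolding has_complete_minor_iff by (elim exE conjE) (rule that)
  have "\<exists>x<r. B x \<inter> verts G = {}"
    using complete_minor_of_clique_sum_side[OF G _ B] clique no_minor(1) by blast
  then obtain x where x: "x < r" "B x \<inter> verts G = {}" by blast
  have "\<exists>y<r. B y \<inter> verts G' = {}"
    using complete_minor_of_clique_sum_side[OF G(2,1) _ B[unfolded graph_union_commute[of G]]]
      clique no_minor(2) by blast
  then obtain y where y: "y < r" "B y \<inter> verts G' = {}" by blast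
  have "x \<noteq> y"
    using x y B(1) unfolding connected_in_def by fastforce
  then obtain u v where "u \<in> B x" "v \<in> B y" "{u, v} \<in> edges G \<or> {u, v} \<in> edges G'"
    using B(3) x(1) y(1) unfolding graph_union_simps Un_iff by blast
  then show False
    using x y simple_graph_edgeD[OF G(1)] simple_graph_edgeD[OF G(2)] by blast
qed

section \<open>Minors in subcubic graphs\<close>

lemma finite_edges: "simple_graph G \<Longrightarrow> finite (edges G)"
  unfolding simple_graph_def by (meson PowI finite_Pow_iff finite_subset subsetI)

text \<open>The edge count of a spanning tree, obtained without trees: a proper nonempty part
  \<open>T\<close> of \<open>S\<close> has an edge to a vertex of \<open>S - T\<close>, so each
  vertex added to \<open>T\<close> gains a new edge.\<close>

lemma card_le_inner_edges_Suc:
  assumes G: "simple_graph G" and S: "connected_in G S"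
  shows "card S \<le> card {e \<in> edges G. e \<subseteq> S} + 1"
proof -
  have fin: "finite S"
    using assms by (auto simp: simple_graph_def connected_in_def intro: finite_subset)
  have "\<exists>T\<subseteq>S. card T = Suc n \<and> n \<le> card {e \<in> edges G. e \<subseteq> T}" if "Suc n \<le> card S" for n
    using that
  proof (induction n)
    case 0
    obtain s where "s \<in> S" using S by (auto simp: connected_in_def)
    then show ?case by (intro exI[of _ "{s}"]) auto
  next
    case (Suc n)
    then obtain T where T: "T \<subseteq> S" "card T = Suc n" "n \<le> card {e \<in> edges G. e \<subseteq> T}"
      by auto
    have "T \<noteq> S" "T \<noteq> {}"
      using T Suc.prems by auto
    then obtain a b where ab: "a \<in> T" "b \<in> S" "b \<notin> T"
      using T(1) by blast
    have "\<exists>c d. c \<in> T \<and> d \<in> S - T \<and> {c, d} \<in> edges G"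
    proof (rule ccontr)
      assume *: "\<not> ?thesis"
      have "(a, v) \<in> (links G S)\<^sup>* \<Longrightarrow> v \<in> T" for v
        by (induction rule: rtrancl_induct) (use * ab in auto)
      with ab T(1) connected_inD[OF S, of a b] show False by blast
    qed
    then obtain c d where cd: "c \<in> T" "d \<in> S - T" "{c, d} \<in> edges G"
      by blast
    have "finite T" using T(1) fin finite_subset by blast
    have "insert {c, d} {e \<in> edges G. e \<subseteq> T} \<subseteq> {e \<in> edges G. e \<subseteq> insert d T}"
      using cd by auto
    then have "card (insert {c, d} {e \<in> edges G. e \<subseteq> T}) \<le> card {e \<in> edges G. e \<subseteq> insert d T}"
      using finite_edges[OF G] by (intro card_mono) auto
    moreover have "card (insert {c, d} {e \<in> edges G. e \<subseteq> T}) = Suc (card {e \<in> edges G. e \<subseteq> T})"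
      using finite_edges[OF G] cd by (intro card_insert_disjoint) auto
    ultimately show ?case
      using T cd \<open>finite T\<close> by (intro exI[of _ "insert d T"]) auto
  qed
  from this[of "card S - 1"] obtain T where T: "card S \<noteq> 0 \<Longrightarrow> T \<subseteq> S"
      "card S \<noteq> 0 \<Longrightarrow> card T = card S" "card S \<noteq> 0 \<Longrightarrow> card S - 1 \<le> card {e \<in> edges G. e \<subseteq> T}"
    by (cases "card S = 0") auto
  show ?thesis
  proof (cases "card S = 0")
    case False
    then have "T = S"
      using T fin card_subset_eq by blast
    then show ?thesis using T(3) False by simp
  qed simp
qed

text \<open>Incidences between \<open>S\<close> and \<open>E\<close>, counted from both
  sides.\<close>

lemma sum_degree_eq:
  fixes E :: "'a set set"
  assumes "finite E" "finite S"
  shows "(\<Sum>v\<in>S. card {e \<in> E. v \<in> e}) = (\<Sum>e\<in>E. card (e \<inter> S))"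
proof -
  have "(\<Sum>v\<in>S. card {e \<in> E. v \<in> e}) = (\<Sum>v\<in>S. \<Sum>e\<in>E. of_bool (v \<in> e))"
    using assms by (simp add: sum_of_bool_eq Int_def)
  also have "\<dots> = (\<Sum>e\<in>E. \<Sum>v\<in>S. of_bool (v \<in> e))"
    by (rule sum.swap)
  also have "\<dots> = (\<Sum>e\<in>E. card (e \<inter> S))"
    using assms by (simp add: sum_of_bool_eq Int_def conj_commute)
  finally show ?thesis .
qed

text \<open>
  A connected set of \<open>b\<close> vertices spans at least \<open>b - 1\<close> edges, so at most \<open>3 b - 2 (b - 1) = b + 2\<close>
  edges leave it; a branch set needs \<open>r - 1\<close> of them.
\<close>

lemma not_complete_minor_subcubic:
  assumes G: "simple_graph G"
    and deg: "\<And>v. v \<in> verts G \<Longrightarrow> card {e \<in> edges G. v \<in> e} \<le> 3"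
    and small: "card (verts G) < r * (r - 3)"
  shows "\<not> has_minor G (complete_graph r)"
proof
  assume "has_minor G (complete_graph r)"
  then obtain B where B: "\<forall>x<r. connected_in G (B x)"
    "\<forall>x<r. \<forall>y<r. x \<noteq> y \<longrightarrow> B x \<inter> B y = {}"
    "\<forall>x<r. \<forall>y<r. x \<noteq> y \<longrightarrow> (\<exists>u\<in>B x. \<exists>v\<in>B y. {u, v} \<in> edges G)"
    unfolding has_complete_minor_iff by (elim exE conjE) (rule that)
  have finV: "finite (verts G)"
    using G by (simp add: simple_graph_def)
  have BV: "B x \<subseteq> verts G" if "x < r" for x
    using B(1) that by (auto simp: connected_in_def)
  have finB: "finite (B x)" if "x < r" for x
    using BV[OF that] finV finite_subset by blast
  have "r - 3 \<le> card (B x)" if x: "x < r" for x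
  proof -
    let ?E = "edges G" and ?I = "{e \<in> edges G. e \<subseteq> B x}"
    \<comment> \<open>One edge from \<open>B x\<close> to each other branch set. Their far ends lie
      in pairwise disjoint sets, so these are \<open>r - 1\<close> distinct edges.\<close>
    define g where "g y = (SOME e. \<exists>u\<in>B x. \<exists>v\<in>B y. e = {u, v} \<and> e \<in> ?E)" for y
    have g: "\<exists>u\<in>B x. \<exists>v\<in>B y. g y = {u, v} \<and> g y \<in> ?E" if "y \<in> {..<r} - {x}" for y
    proof -
      have "\<exists>e. \<exists>u\<in>B x. \<exists>v\<in>B y. e = {u, v} \<and> e \<in> ?E"
        using B(3)[rule_format, of x y] x that by auto
      then show ?thesis unfolding g_def by (rule someI_ex)
    qed
    let ?O = "g ` ({..<r} - {x})"
    have "inj_on g ({..<r} - {x})"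
    proof (rule inj_onI)
      fix y z assume yz: "y \<in> {..<r} - {x}" "z \<in> {..<r} - {x}" "g y = g z"
      obtain u v where uv: "u \<in> B x" "v \<in> B y" "g y = {u, v}"
        using g[OF yz(1)] by blast
      obtain u' v' where uv': "u' \<in> B x" "v' \<in> B z" "g z = {u', v'}"
        using g[OF yz(2)] by blast
      have "B x \<inter> B z = {}"
        using B(2) x yz by auto
      then have "v' = v"
        using uv uv' yz(3) by (auto simp: doubleton_eq_iff)
      then show "y = z"
        using B(2) uv uv' yz by blast
    qed
    then have cO: "card ?O = r - 1"
      using x by (simp add: card_image)
    have O: "e \<in> ?E" "\<not> e \<subseteq> B x" "e \<inter> B x \<noteq> {}" if e: "e \<in> ?O" for e
    proof -
      obtain y where y: "y \<in> {..<r} - {x}" "e = g y"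
        using e by blast
      then have "B x \<inter> B y = {}"
        using B(2) x by auto
      then show "e \<in> ?E" "\<not> e \<subseteq> B x" "e \<inter> B x \<noteq> {}"
        using g[OF y(1)] y(2) by blast+
    qed
    have finE: "finite ?E" "finite ?I" "finite ?O"
      using finite_edges[OF G] by auto
    have two: "card (e \<inter> B x) = 2" if "e \<in> ?I" for e
      using that G by (auto simp: simple_graph_def Int_absorb2)
    have one: "1 \<le> card (e \<inter> B x)" if "e \<in> ?O" for e
      using O(3)[OF that] finB[OF x] by (simp add: Suc_le_eq card_gt_0_iff)
    \<comment> \<open>Degree count over \<open>B x\<close>: inner edges are seen from both ends, the
      chosen outgoing ones from at least one.\<close>
    have "2 * card ?I + (r - 1) = (\<Sum>e\<in>?I. 2) + (\<Sum>e\<in>?O. 1)"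
      using cO by simp
    also have "\<dots> \<le> (\<Sum>e\<in>?I. card (e \<inter> B x)) + (\<Sum>e\<in>?O. card (e \<inter> B x))"
      using two one by (intro add_mono sum_mono) auto
    also have "\<dots> = (\<Sum>e\<in>?I \<union> ?O. card (e \<inter> B x))"
      using finE O(2) by (intro sum.union_disjoint[symmetric]) auto
    also have "\<dots> \<le> (\<Sum>e\<in>?E. card (e \<inter> B x))"
      using finE O(1) by (intro sum_mono2) auto
    also have "\<dots> = (\<Sum>v\<in>B x. card {e \<in> ?E. v \<in> e})"
      using sum_degree_eq finE(1) finB[OF x] by metis
    also have "\<dots> \<le> (\<Sum>v\<in>B x. 3)"
      using deg BV[OF x] by (intro sum_mono) auto
    finally have "2 * card ?I + (r - 1) \<le> 3 * card (B x)"
      by simp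
    moreover have "card (B x) \<le> card ?I + 1"
      using card_le_inner_edges_Suc[OF G] B(1) x by blast
    ultimately show ?thesis by linarith
  qed
  then have "(\<Sum>x<r. r - 3) \<le> (\<Sum>x<r. card (B x))"
    by (intro sum_mono) auto
  also have "\<dots> = card (\<Union>x<r. B x)"
    using finB B(2) by (intro card_UN_disjoint[symmetric]) auto
  also have "\<dots> \<le> card (verts G)"
    using BV finV by (intro card_mono) auto
  finally show False
    using small by simp
qed

section \<open>Minor-saturated graphs\<close>

text \<open>Phrased with \<open>has_minor\<close> and over any vertex type: the building blocks have
  vertices in \<open>bool \<times> int\<close>, whereas \<open>saturated\<close> refers to graphs on
  \<open>nat\<close>.\<close>

definition minor_saturated :: "nat \<Rightarrow> 'a graph \<Rightarrow> bool" where
  "minor_saturated r G \<longleftrightarrow> simple_graph G \<and> \<not> has_minor G (complete_graph r) \<and>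
     (\<forall>u\<in>verts G. \<forall>v\<in>verts G. u \<noteq> v \<longrightarrow> {u, v} \<notin> edges G \<longrightarrow>
        has_minor (add_edge G {u, v}) (complete_graph r))"

lemma minor_saturatedD:
  assumes "minor_saturated r G"
  shows "simple_graph G" "\<not> has_minor G (complete_graph r)"
    "\<And>u v. u \<in> verts G \<Longrightarrow> v \<in> verts G \<Longrightarrow> u \<noteq> v \<Longrightarrow> {u, v} \<notin> edges G \<Longrightarrow>
       has_minor (add_edge G {u, v}) (complete_graph r)"
  using assms unfolding minor_saturated_def by simp_all

lemma simple_graph_add_edge:
  "simple_graph G \<Longrightarrow> u \<in> verts G \<Longrightarrow> v \<in> verts G \<Longrightarrow> u \<noteq> v \<Longrightarrow> simple_graph (add_edge G {u, v})"
  by (auto simp: simple_graph_def add_edge_def)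

text \<open>A copy of a class member inside \<open>G\<close> would carry its minor into
  \<open>G\<close>. After adding an edge, the enlarged graph is itself a member of the
  class.\<close>

lemma saturated_if_minor_saturated:
  fixes G :: "nat graph"
  assumes "minor_saturated r G"
  shows "saturated (minor_class (complete_graph r)) G"
  unfolding saturated_def
proof (intro conjI ballI allI impI)
  show "simple_graph G" by (rule minor_saturatedD[OF assms])
  show "\<not> contains_subgraph G F" if "F \<in> minor_class (complete_graph r)" for F
  proof
    assume "contains_subgraph G F"
    then obtain f where "inj_on f (verts F)" "f ` verts F \<subseteq> verts G" "\<forall>e\<in>edges F. f ` e \<in> edges G"
      by (auto simp: contains_subgraph_def)
    moreover have "has_minor F (complete_graph r)"
      using that by (simp add: minor_class_def)
    ultimately show False
      using has_minor_embed minor_saturatedD(2)[OF assms] by blast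
  qed
  fix e assume e: "e \<subseteq> verts G \<and> card e = 2 \<and> e \<notin> edges G"
  then obtain u v where uv: "e = {u, v}" "u \<noteq> v"
    by (auto simp: card_2_iff)
  have "add_edge G e \<in> minor_class (complete_graph r)"
    using e uv minor_saturatedD[OF assms] simple_graph_add_edge by (auto simp: minor_class_def)
  moreover have "contains_subgraph (add_edge G e) (add_edge G e)"
    unfolding contains_subgraph_def by (intro exI[of _ id]) auto
  ultimately show "\<exists>F\<in>minor_class (complete_graph r). contains_subgraph (add_edge G e) F"
    by blast
qed

lemma sat_le_if_minor_saturated:
  fixes G :: "nat graph"
  assumes "minor_saturated r G" "card (verts G) = n"
  shows "sat n (minor_class (complete_graph r)) \<le> card (edges G)"
  unfolding sat_def using saturated_if_minor_saturated[OF assms(1)] assms(2) by (intro Least_le) auto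

section \<open>Relabelling and gluing along an edge\<close>

definition relabel :: "('a \<Rightarrow> 'b) \<Rightarrow> 'a graph \<Rightarrow> 'b graph" where
  "relabel f G = \<lparr>verts = f ` verts G, edges = (`) f ` edges G\<rparr>"

lemma relabel_simps [simp]:
  "verts (relabel f G) = f ` verts G" "edges (relabel f G) = (`) f ` edges G"
  by (simp_all add: relabel_def)

lemma relabel_edge_iff:
  assumes G: "simple_graph G" and f: "inj_on f (verts G)" and ab: "a \<in> verts G" "b \<in> verts G"
  shows "{f a, f b} \<in> edges (relabel f G) \<longleftrightarrow> {a, b} \<in> edges G"
proof -
  have "edges G \<subseteq> Pow (verts G)"
    using G by (auto simp: simple_graph_def)
  then show ?thesis
    using inj_on_image_mem_iff[OF inj_on_image_Pow[OF f], of "{a, b}" "edges G"] ab by simp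
qed

lemma minor_saturated_relabel:
  assumes G: "minor_saturated r G" and f: "inj_on f (verts G)"
  shows "minor_saturated r (relabel f G)"
  unfolding minor_saturated_def
proof (intro conjI ballI impI)
  let ?g = "inv_into (verts G) f"
  have sub: "e \<subseteq> verts G" if "e \<in> edges G" for e
    using that minor_saturatedD(1)[OF G] by (auto simp: simple_graph_def)
  show "simple_graph (relabel f G)"
    using minor_saturatedD(1)[OF G] f
    by (auto simp: simple_graph_def card_image inj_on_subset image_mono)
  have "?g ` f ` e = e" if "e \<in> edges G" for e
    using inv_into_image_cancel[OF f sub[OF that]] .
  then have "has_minor G H" if "has_minor (relabel f G) H" for H :: "nat graph"
    by (intro has_minor_embed[OF that, of ?g]) (use f in \<open>auto simp: inj_on_inv_into\<close>)
  then show "\<not> has_minor (relabel f G) (complete_graph r)"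
    using minor_saturatedD(2)[OF G] by blast
  fix u v assume uv: "u \<in> verts (relabel f G)" "v \<in> verts (relabel f G)" "u \<noteq> v"
    "{u, v} \<notin> edges (relabel f G)"
  obtain a b where ab: "a \<in> verts G" "b \<in> verts G" "u = f a" "v = f b"
    using uv by auto
  then have "{a, b} \<notin> edges G"
    using uv(4) relabel_edge_iff[OF minor_saturatedD(1)[OF G] f] by blast
  then have "has_minor (add_edge G {a, b}) (complete_graph r)"
    using minor_saturatedD(3)[OF G] ab uv by blast
  then show "has_minor (add_edge (relabel f G) {u, v}) (complete_graph r)"
    by (rule has_minor_embed[of _ _ f]) (use f ab in \<open>auto simp: add_edge_def\<close>)
qed

text \<open>The roles are asymmetric, since a new edge between the sides is always contracted into
  \<open>G\<close>. So the triangle condition falls on \<open>G\<close> and the connectivity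
  condition on \<open>G'\<close>; \<open>G\<close> can be a whole chain of copies while
  \<open>G'\<close> is a single block.\<close>

lemma minor_saturated_glue:
  assumes G: "minor_saturated r G" and G': "minor_saturated r G'"
    and xy: "verts G \<inter> verts G' = {x, y}" "{x, y} \<in> edges G" "{x, y} \<in> edges G'"
    and no_triangle: "\<And>u. {u, x} \<in> edges G \<Longrightarrow> {u, y} \<notin> edges G"
    and conn: "connected_in G' (verts G' - {x})" "connected_in G' (verts G' - {y})"
  shows "minor_saturated r (graph_union G G')"
proof -
  note [simp] = add_edge_def
  have "x \<noteq> y"
    using simple_graph_edgeD[OF minor_saturatedD(1)[OF G] xy(2)] by blast
  have across: "has_minor (add_edge (graph_union G G') {u, v}) (complete_graph r)"
    if u: "u \<in> verts G - verts G'" and v: "v \<in> verts G' - verts G" for u v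
  proof -
    \<comment> \<open>\<open>z\<close> is an end of the shared edge that \<open>u\<close> misses.
      The rest of \<open>G'\<close> is merged into \<open>z\<close>, while the other end
      \<open>w\<close> stays separate.\<close>
    obtain z w where zw: "{z, w} = {x, y}" "z \<noteq> w" "{u, z} \<notin> edges G"
      using no_triangle[of u] \<open>x \<noteq> y\<close> by (metis insert_commute)
    then have zV: "z \<in> verts G" "z \<in> verts G'"
      using xy(1) by blast+
    have eq: "insert z (verts G' - {x, y}) = verts G' - {w}"
      using zw zV by (auto simp: doubleton_eq_iff)
    have "has_minor (add_edge G {u, z}) (complete_graph r)"
      using minor_saturatedD(3)[OF G] u zV zw by blast
    then show ?thesis
    proof (rule has_minor_contract)
      have "connected_in G' (verts G' - {w})"
        using zw(1) conn by (auto simp: doubleton_eq_iff)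
      then show "connected_in (add_edge (graph_union G G') {u, v}) (insert z (verts G' - {x, y}))"
        unfolding eq by (rule connected_in_mono) auto
      show "v \<in> verts G' - {x, y}"
        using v xy(1) by blast
    qed (use xy in auto)
  qed
  show ?thesis
    unfolding minor_saturated_def
  proof (intro conjI ballI impI)
    show "simple_graph (graph_union G G')"
      using minor_saturatedD(1) G G' simple_graph_union by blast
    have "{u, v} = {x, y}" if "u \<in> {x, y}" "v \<in> {x, y}" "u \<noteq> v" for u v
      using that by auto
    then show "\<not> has_minor (graph_union G G') (complete_graph r)"
      using xy minor_saturatedD[OF G] minor_saturatedD[OF G']
      by (intro not_complete_minor_clique_sum) auto
    fix u v assume uv: "u \<in> verts (graph_union G G')" "v \<in> verts (graph_union G G')" "u \<noteq> v"
      "{u, v} \<notin> edges (graph_union G G')"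
    then consider "u \<in> verts G" "v \<in> verts G" | "u \<in> verts G'" "v \<in> verts G'"
      | "u \<in> verts G - verts G'" "v \<in> verts G' - verts G"
      | "v \<in> verts G - verts G'" "u \<in> verts G' - verts G"
      by auto
    then show "has_minor (add_edge (graph_union G G') {u, v}) (complete_graph r)"
    proof cases
      case 1
      then have "has_minor (add_edge G {u, v}) (complete_graph r)"
        using minor_saturatedD(3)[OF G] uv by simp
      then show ?thesis by (rule has_minor_mono) auto
    next
      case 2
      then have "has_minor (add_edge G' {u, v}) (complete_graph r)"
        using minor_saturatedD(3)[OF G'] uv by simp
      then show ?thesis by (rule has_minor_mono) auto
    next
      case 3
      then show ?thesis by (rule across)
    next
      case 4
      then show ?thesis using across[of v u] by (simp only: insert_commute)
    qed
  qed
qed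

section \<open>Adding a single vertex\<close>

definition attach :: "'a graph \<Rightarrow> 'a \<Rightarrow> 'a set \<Rightarrow> 'a graph" where
  "attach G z A = \<lparr>verts = insert z (verts G), edges = edges G \<union> (\<lambda>a. {a, z}) ` A\<rparr>"

lemma attach_simps [simp]:
  "verts (attach G z A) = insert z (verts G)"
  "edges (attach G z A) = edges G \<union> (\<lambda>a. {a, z}) ` A"
  by (simp_all add: attach_def)

text \<open>
  The new vertex \<open>z\<close> is joined to a maximal set \<open>A\<close> that creates no \<open>K\<^sup>r\<close> minor. Two nonadjacent
  vertices \<open>u, v\<close> of \<open>A\<close> would give \<open>G + uv\<close>, hence \<open>K\<^sup>r\<close>, as a minor, so \<open>A\<close> is a clique.
\<close>

lemma minor_saturated_extend:
  assumes G: "minor_saturated r G" and z: "z \<notin> verts G" and r: "2 \<le> r"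
  obtains G' where "minor_saturated r G'" "verts G' = insert z (verts G)"
    "card (edges G') \<le> card (edges G) + r"
proof -
  note sG = minor_saturatedD(1)[OF G]
  have finV: "finite (verts G)"
    using sG by (simp add: simple_graph_def)
  define P where "P A \<longleftrightarrow> A \<subseteq> verts G \<and> \<not> has_minor (attach G z A) (complete_graph r)" for A
  \<comment> \<open>Adding \<open>z\<close> as an isolated vertex is a clique sum over the empty
    overlap. So the empty set is a candidate, and a candidate of greatest size exists.\<close>
  let ?Z = "\<lparr>verts = {z}, edges = {}\<rparr>"
  have "\<not> has_minor ?Z (complete_graph r)"
    using r by (intro not_complete_minor_if_card_less) auto
  then have "\<not> has_minor (graph_union G ?Z) (complete_graph r)"
    using z sG minor_saturatedD(2)[OF G]
    by (intro not_complete_minor_clique_sum) (auto simp: simple_graph_def)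
  moreover have "graph_union G ?Z = attach G z {}"
    by (simp add: graph_union_def attach_def)
  ultimately have "P {}" by (simp add: P_def)
  moreover have "\<forall>A. P A \<longrightarrow> card A \<le> card (verts G)"
    using finV by (auto simp: P_def intro: card_mono)
  ultimately obtain A where A: "P A" and max: "\<And>A'. P A' \<Longrightarrow> card A' \<le> card A"
    using ex_has_greatest_nat[of P "{}" card "Suc (card (verts G))"] by (auto simp: less_Suc_eq_le)
  have AV: "A \<subseteq> verts G" and no_minor: "\<not> has_minor (attach G z A) (complete_graph r)"
    using A by (simp_all add: P_def)
  have finA: "finite A" using AV finV finite_subset by blast
  have clique: "{u, v} \<in> edges G" if uv: "u \<in> A" "v \<in> A" "u \<noteq> v" for u v
  proof (rule ccontr)
    assume "{u, v} \<notin> edges G"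
    then have "has_minor (add_edge G {u, v}) (complete_graph r)"
      using minor_saturatedD(3)[OF G] uv AV by blast
    then have "has_minor (attach G z A) (complete_graph r)"
    proof (rule has_minor_contract)
      have "{v, z} \<in> edges (attach G z A)"
        using uv by auto
      then show "connected_in (attach G z A) (insert v {z})"
        using uv AV by (intro connected_inI[of v]) auto
    qed (use z uv in auto)
    with no_minor show False by blast
  qed
  \<comment> \<open>A clique of at least \<open>r\<close> vertices would already give
    \<open>G\<close> a complete minor.\<close>
  have "card A \<le> r"
    using complete_minor_if_clique[OF AV finA, of r] clique minor_saturatedD(2)[OF G]
    by (meson nat_le_linear)
  then have "card ((\<lambda>a. {a, z}) ` A) \<le> r"
    using card_image_le[OF finA] order_trans by blast
  then have card: "card (edges (attach G z A)) \<le> card (edges G) + r"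
    using card_Un_le[of "edges G" "(\<lambda>a. {a, z}) ` A"] by simp
  have new: "has_minor (add_edge (attach G z A) {v, z}) (complete_graph r)"
    if v: "v \<in> verts G" "v \<notin> A" for v
  proof -
    \<comment> \<open>Maximality of \<open>A\<close> is what yields saturation at the pairs
      containing \<open>z\<close>.\<close>
    have "\<not> P (insert v A)"
      using max[of "insert v A"] v finA by auto
    then have "has_minor (attach G z (insert v A)) (complete_graph r)"
      using v AV by (simp add: P_def)
    then show ?thesis
      by (rule has_minor_mono) (auto simp: add_edge_def)
  qed
  have "minor_saturated r (attach G z A)"
    unfolding minor_saturated_def
  proof (intro conjI ballI impI)
    have "card {a, z} = 2" if "a \<in> A" for a
      using that AV z by (cases "a = z") auto
    then show "simple_graph (attach G z A)"
      using sG AV by (auto simp: simple_graph_def)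
    show "\<not> has_minor (attach G z A) (complete_graph r)" by (rule no_minor)
    fix u v assume uv: "u \<in> verts (attach G z A)" "v \<in> verts (attach G z A)" "u \<noteq> v"
      "{u, v} \<notin> edges (attach G z A)"
    then consider "u \<in> verts G" "v \<in> verts G" | "u \<in> verts G" "v = z" | "v \<in> verts G" "u = z"
      by auto
    then show "has_minor (add_edge (attach G z A) {u, v}) (complete_graph r)"
    proof cases
      case 1
      then have "has_minor (add_edge G {u, v}) (complete_graph r)"
        using minor_saturatedD(3)[OF G] uv by simp
      then show ?thesis by (rule has_minor_mono) (auto simp: add_edge_def)
    next
      case 2
      then show ?thesis using new[of u] uv by auto
    next
      case 3
      then show ?thesis using new[of v] uv by (auto simp: insert_commute)
    qed
  qed
  then show thesis
    using that card by simp
qed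

section \<open>Chains of glued copies and the asymptotic bound\<close>

locale gluing_block =
  fixes r :: nat and H :: "'a graph" and x y :: 'a
  assumes r: "3 \<le> r"
    and saturated: "minor_saturated r H"
    and edge: "{x, y} \<in> edges H"
    and no_triangle: "\<And>u. {u, x} \<in> edges H \<Longrightarrow> {u, y} \<notin> edges H"
    and connected: "connected_in H (verts H - {x})" "connected_in H (verts H - {y})"
begin

lemma fresh_copy:
  fixes V :: "nat set"
  assumes "finite V" "{0, 1} \<subseteq> V"
  obtains f where "inj_on f (verts H)" "f x = 0" "f y = 1" "V \<inter> f ` verts H = {0, 1}"
proof -
  note H = minor_saturatedD(1)[OF saturated]
  have xy: "x \<in> verts H" "y \<in> verts H" "x \<noteq> y"
    using simple_graph_edgeD[OF H edge] by auto
  have fin: "finite (verts H - {x, y})"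
    using H by (simp add: simple_graph_def)
  obtain T where T: "finite T" "card T = card (verts H - {x, y})" "T \<subseteq> - V"
    using infinite_arbitrarily_large[of "- V" "card (verts H - {x, y})"] assms(1)
    by (auto simp: Compl_eq_Diff_UNIV)
  obtain h where h: "bij_betw h (verts H - {x, y}) T"
    using finite_same_card_bij[OF fin T(1)] T(2) by auto
  define f where "f = h(x := 0, y := 1)"
  have im: "f ` (verts H - {x, y}) = T"
    using h by (auto simp: f_def bij_betw_def)
  have split: "verts H = insert x (insert y (verts H - {x, y}))"
    using xy by auto
  then have "f ` verts H = insert (f x) (insert (f y) T)"
    using im by (metis image_insert)
  then have "V \<inter> f ` verts H = {0, 1}"
    using T(3) assms(2) xy(3) by (auto simp: f_def)
  moreover have "inj_on f (verts H)"
  proof -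
    have "inj_on f (verts H - {x, y})"
      using bij_betw_imp_inj_on[OF h] by (rule inj_on_cong[THEN iffD1, rotated]) (auto simp: f_def)
    moreover have "f x \<notin> insert (f y) T" "f y \<notin> T"
      using T(3) assms(2) xy(3) by (auto simp: f_def)
    ultimately have "inj_on f (insert x (insert y (verts H - {x, y})))"
      using im by (auto simp: inj_on_insert)
    then show ?thesis using split by simp
  qed
  ultimately show thesis
    using that[of f] xy(3) by (simp add: f_def)
qed

text \<open>All copies share the edge \<open>{0, 1}\<close>. That it lies in no triangle belongs to
  the induction, because the chain built so far is the side into which the next gluing
  contracts.\<close>

lemma glued_copies:
  "\<exists>G :: nat graph. minor_saturated r G \<and> {0, 1} \<in> edges G \<and>
     (\<forall>u. {u, 0} \<in> edges G \<longrightarrow> {u, 1} \<notin> edges G) \<and>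
     card (verts G) = 2 + k * (card (verts H) - 2) \<and>
     card (edges G) \<le> 1 + k * (card (edges H) - 1)"
proof (induction k)
  case 0
  \<comment> \<open>A single edge is complete, so saturation is vacuous, and with two vertices it is
    too small for a minor, as \<open>3 \<le> r\<close>.\<close>
  let ?G = "\<lparr>verts = {0, 1 :: nat}, edges = {{0, 1}}\<rparr>"
  have "minor_saturated r ?G"
    unfolding minor_saturated_def
    using r not_complete_minor_if_card_less[of ?G r] by (auto simp: simple_graph_def insert_commute)
  then show ?case
    by (intro exI[of _ ?G]) (auto simp: doubleton_eq_iff)
next
  case (Suc k)
  then obtain G :: "nat graph" where G: "minor_saturated r G" "{0, 1} \<in> edges G"
    "\<And>u. {u, 0} \<in> edges G \<Longrightarrow> {u, 1} \<notin> edges G"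
    "card (verts G) = 2 + k * (card (verts H) - 2)"
    "card (edges G) \<le> 1 + k * (card (edges H) - 1)"
    by blast
  note sG = minor_saturatedD(1)[OF G(1)]
  note sH = minor_saturatedD(1)[OF saturated]
  have fin: "finite (verts G)" "finite (verts H)"
    using sG sH by (simp_all add: simple_graph_def)
  have "{0, 1} \<subseteq> verts G"
    using simple_graph_edgeD[OF sG G(2)] by simp
  from fresh_copy[OF fin(1) this]
  obtain f where f: "inj_on f (verts H)" "f x = 0" "f y = 1" "verts G \<inter> f ` verts H = {0, 1}"
    by blast
  let ?H = "relabel f H"
  have satH: "minor_saturated r ?H"
    by (rule minor_saturated_relabel[OF saturated f(1)])
  have xy: "x \<in> verts H" "y \<in> verts H" "x \<noteq> y"
    using simple_graph_edgeD[OF sH edge] by auto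
  have edgeH: "{0, 1} \<in> edges ?H"
    using relabel_edge_iff[OF sH f(1) xy(1,2)] edge f(2,3) by simp
  have no_triangle_H: "{u, 1} \<notin> edges ?H" if u: "{u, 0} \<in> edges ?H" for u
  proof
    assume u': "{u, 1} \<in> edges ?H"
    have "u \<in> verts ?H"
      using simple_graph_edgeD[OF minor_saturatedD(1)[OF satH] u] by simp
    then obtain a where a: "a \<in> verts H" "u = f a" by auto
    have "{a, x} \<in> edges H" "{a, y} \<in> edges H"
      using relabel_edge_iff[OF sH f(1) a(1)] xy u u' a(2) f(2,3) by metis+
    then show False using no_triangle by blast
  qed
  have conn: "connected_in ?H (verts ?H - {f z})" if "z \<in> {x, y}" for z
  proof -
    have "connected_in ?H (f ` (verts H - {z}))"
      using that connected by (intro connected_in_image) auto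
    moreover have "f ` (verts H - {z}) = verts ?H - {f z}"
      using that xy f(1) inj_on_image_set_diff[OF f(1), of "verts H" "{z}"] by auto
    ultimately show ?thesis by simp
  qed
  let ?U = "graph_union G ?H"
  have "minor_saturated r ?U"
    using minor_saturated_glue[OF G(1) satH _ G(2) edgeH G(3)] f conn[of x] conn[of y] by simp
  moreover have "{u, 1} \<notin> edges ?U" if u: "{u, 0} \<in> edges ?U" for u
  proof
    assume u': "{u, 1} \<in> edges ?U"
    have sH': "simple_graph ?H" by (rule minor_saturatedD(1)[OF satH])
    \<comment> \<open>A triangle on the shared edge with its other sides from different graphs has
      its third vertex in the overlap, hence at an end of that edge.\<close>
    have "u \<in> {0, 1}"
      if "{u, a} \<in> edges G" "{u, b} \<in> edges ?H" for a b
      using simple_graph_edgeD[OF sG that(1)] simple_graph_edgeD[OF sH' that(2)] f(4) by auto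
    moreover have "u \<noteq> 0" "u \<noteq> 1"
      using simple_graph_edgeD(3)[OF simple_graph_union[OF sG sH']] u u' by blast+
    ultimately show False
      using u u' G(3) no_triangle_H by (metis Un_iff graph_union_simps(2) insertE singletonD)
  qed
  moreover have "card (verts ?U) = 2 + Suc k * (card (verts H) - 2)"
  proof -
    have "card {x, y} \<le> card (verts H)"
      using xy fin by (intro card_mono) auto
    moreover have "card (f ` verts H) = card (verts H)"
      by (rule card_image[OF f(1)])
    moreover have "card (verts G) + card (f ` verts H) = card (verts ?U) + card {0 :: nat, 1}"
      using card_Un_Int[of "verts G" "f ` verts H"] fin f(4) by simp
    ultimately show ?thesis
      using G(4) xy(3) by simp
  qed
  moreover have "card (edges ?U) \<le> 1 + Suc k * (card (edges H) - 1)"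
  proof -
    have finE: "finite (edges G)" "finite (edges H)"
      using finite_edges sG sH by auto
    have "card (edges ?H) \<le> card (edges H)"
      using card_image_le[OF finE(2)] by simp
    moreover have "card (edges G) + card (edges ?H) = card (edges ?U) + card (edges G \<inter> edges ?H)"
      using card_Un_Int[of "edges G" "edges ?H"] finE by simp
    \<comment> \<open>The shared edge is counted in both graphs; this saves one edge per
      copy.\<close>
    moreover have "card {{0 :: nat, 1}} \<le> card (edges G \<inter> edges ?H)"
      using finE G(2) edgeH by (intro card_mono) auto
    ultimately show ?thesis
      using G(5) by simp
  qed
  ultimately show ?case
    using G(2) by (intro exI[of _ ?U]) simp
qed

lemma ex_minor_saturated:
  "\<exists>G :: nat graph. minor_saturated r G \<and> card (verts G) = 2 + k * (card (verts H) - 2) + s \<and>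
     card (edges G) \<le> 1 + k * (card (edges H) - 1) + s * r"
proof (induction s)
  case 0
  then show ?case using glued_copies[of k] by auto
next
  case (Suc s)
  then obtain G :: "nat graph" where G: "minor_saturated r G"
    "card (verts G) = 2 + k * (card (verts H) - 2) + s"
    "card (edges G) \<le> 1 + k * (card (edges H) - 1) + s * r"
    by blast
  have fin: "finite (verts G)"
    using minor_saturatedD(1)[OF G(1)] by (simp add: simple_graph_def)
  then obtain z where z: "z \<notin> verts G"
    using ex_new_if_finite infinite_UNIV_nat by blast
  obtain G' where "minor_saturated r G'" "verts G' = insert z (verts G)"
    "card (edges G') \<le> card (edges G) + r"
    by (rule minor_saturated_extend[OF G(1) z]) (use r in auto)
  then show ?case
    using G z fin by (intro exI[of _ G']) auto
qed

lemma sat_asymptotic_bound: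
  assumes N: "card (verts H) = N + 2" "0 < N" and M: "card (edges H) \<le> M + 1"
  shows "\<exists>h \<in> O(\<lambda>_. 1 :: real). \<forall>\<^sub>F n in sequentially.
    real (sat n (minor_class (complete_graph r))) \<le> real M / real N * real n + h n"
proof (intro bexI)
  show "(\<lambda>_. 1 + real N * real r) \<in> O(\<lambda>_. 1 :: real)"
    by (intro bigoI[of _ "1 + real N * real r"]) auto
  have "real (sat n (minor_class (complete_graph r))) \<le> real M / real N * real n + (1 + real N * real r)"
    if n: "2 \<le> n" for n
  proof -
    \<comment> \<open>Two of the \<open>n\<close> vertices are the ends of the shared edge. Fewer
      than \<open>N\<close> vertices are left over after \<open>?k\<close> copies; their edges, at
      most \<open>N * r\<close>, go into the constant.\<close>
    let ?k = "(n - 2) div N" and ?s = "(n - 2) mod N"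
    obtain G :: "nat graph" where G: "minor_saturated r G" "card (verts G) = 2 + ?k * N + ?s"
      "card (edges G) \<le> 1 + ?k * (card (edges H) - 1) + ?s * r"
      using ex_minor_saturated[of ?k ?s] N(1) by auto
    have "card (verts G) = n"
      using G(2) n by simp
    then have "sat n (minor_class (complete_graph r)) \<le> card (edges G)"
      by (rule sat_le_if_minor_saturated[OF G(1)])
    also have "\<dots> \<le> 1 + ?k * M + N * r"
    proof -
      have "?k * (card (edges H) - 1) \<le> ?k * M" "?s * r \<le> N * r"
        using M N(2) by (auto intro!: mult_le_mono simp: less_imp_le)
      then show ?thesis using G(3) by linarith
    qed
    finally have "real (sat n (minor_class (complete_graph r))) \<le> real (1 + ?k * M + N * r)"
      by (rule of_nat_mono)
    moreover have "real ?k \<le> real n / real N"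
    proof -
      have "?k * N \<le> n"
        by (rule order_trans[OF div_times_less_eq_dividend]) simp
      then have "real ?k * real N \<le> real n"
        by (metis of_nat_le_iff of_nat_mult)
      then show ?thesis
        using N(2) by (simp add: pos_le_divide_eq)
    qed
    then have "real ?k * real M \<le> real n / real N * real M"
      by (rule mult_right_mono) simp
    ultimately show ?thesis
      by (simp add: mult.commute)
  qed
  then show "\<forall>\<^sub>F n in sequentially. real (sat n (minor_class (complete_graph r)))
      \<le> real M / real N * real n + (1 + real N * real r)"
    using eventually_ge_at_top[of 2] by (rule eventually_mono[rotated])
qed

end

section \<open>Certificates for complete minors\<close>

text \<open>Every entry but the last has an \<open>R\<close>-neighbour further right, so the last
  entry acts as the root of a spanning tree.\<close>

fun attached :: "('a \<Rightarrow> 'a \<Rightarrow> bool) \<Rightarrow> 'a list \<Rightarrow> bool" where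
  "attached R [] = True"
| "attached R (v # vs) = ((vs = [] \<or> list_ex (R v) vs) \<and> attached R vs)"

lemma connected_in_if_attached:
  assumes "attached R vs" "vs \<noteq> []" "set vs \<subseteq> verts G"
    and R: "\<And>u v. u \<in> verts G \<Longrightarrow> v \<in> verts G \<Longrightarrow> R u v \<Longrightarrow> {u, v} \<in> edges G"
  shows "connected_in G (set vs)"
proof -
  have "v \<in> set vs \<Longrightarrow> (v, last vs) \<in> (links G (set vs))\<^sup>*" for v
    using assms(1-3)
  proof (induction vs arbitrary: v)
    case (Cons w ws)
    have mono: "(a, b) \<in> (links G (set (w # ws)))\<^sup>*" if "(a, b) \<in> (links G (set ws))\<^sup>*" for a b
      by (rule links_rtrancl_mono[OF that]) auto
    show ?case
    proof (cases "ws = []")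
      case True
      then show ?thesis using Cons.prems by simp
    next
      case False
      then have IH: "(u, last ws) \<in> (links G (set (w # ws)))\<^sup>*" if "u \<in> set ws" for u
        using Cons that by (intro mono) auto
      obtain u where u: "u \<in> set ws" "R w u"
        using Cons.prems False by (auto simp: list_ex_iff)
      then have "(w, u) \<in> links G (set (w # ws))"
        using R[of w u] Cons.prems by auto
      then have "(w, last ws) \<in> (links G (set (w # ws)))\<^sup>*"
        using IH[OF u(1)] by (rule converse_rtrancl_into_rtrancl)
      then show ?thesis
        using IH[of v] Cons.prems(1) False by auto
    qed
  qed simp
  then show ?thesis
    using assms(2,3) by (intro connected_inI[of "last vs"] links_rtrancl_sym[of _ "last vs"]) auto
qed

text \<open>Lists and predicates instead of sets and a graph make the test executable. Branch sets
  are compared in list order only, and \<open>attached\<close> also looks to the right, so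
  \<open>R\<close> is only ever read from left to right.\<close>

definition minor_certificate :: "('a \<Rightarrow> 'a \<Rightarrow> bool) \<Rightarrow> ('a \<Rightarrow> bool) \<Rightarrow> 'a list list \<Rightarrow> bool" where
  "minor_certificate R P Bs \<longleftrightarrow>
     list_all (\<lambda>B. B \<noteq> [] \<and> attached R B \<and> list_all P B) Bs \<and>
     sorted_wrt (\<lambda>B C. list_all (\<lambda>x. x \<notin> set C) B \<and> list_ex (\<lambda>u. list_ex (R u) C) B) Bs"

lemma has_complete_minor_if_certificate:
  assumes cert: "minor_certificate R (\<lambda>v. v \<in> verts G) Bs"
    and R: "\<And>u v. u \<in> verts G \<Longrightarrow> v \<in> verts G \<Longrightarrow> R u v \<Longrightarrow> {u, v} \<in> edges G"
  shows "has_minor G (complete_graph (length Bs))"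
proof -
  let ?B = "\<lambda>i. set (Bs ! i)"
  have nth: "Bs ! i \<noteq> []" "attached R (Bs ! i)" "set (Bs ! i) \<subseteq> verts G" if "i < length Bs" for i
    using cert that by (auto simp: minor_certificate_def list_all_iff)
  have less: "?B i \<inter> ?B j = {} \<and> (\<exists>u\<in>?B i. \<exists>v\<in>?B j. {u, v} \<in> edges G)"
    if ij: "i < j" "j < length Bs" for i j
  proof -
    have *: "list_all (\<lambda>x. x \<notin> set (Bs ! j)) (Bs ! i)"
      "list_ex (\<lambda>u. list_ex (R u) (Bs ! j)) (Bs ! i)"
      using cert ij by (auto simp: minor_certificate_def sorted_wrt_iff_nth_less)
    obtain u v where "u \<in> ?B i" "v \<in> ?B j" "R u v"
      using *(2) by (auto simp: list_ex_iff)
    moreover from this have "{u, v} \<in> edges G"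
      using R[of u v] nth(3)[of i] nth(3)[of j] ij by auto
    moreover have "?B i \<inter> ?B j = {}"
      using *(1) by (auto simp: list_all_iff)
    ultimately show ?thesis by blast
  qed
  show ?thesis
    unfolding has_complete_minor_iff
  proof (intro exI[of _ ?B] conjI allI impI)
    fix i j assume "i < length Bs" "j < length Bs" "i \<noteq> j"
    then consider "i < j" "j < length Bs" | "j < i" "i < length Bs" by linarith
    then have "?B i \<inter> ?B j = {} \<and> (\<exists>u\<in>?B i. \<exists>v\<in>?B j. {u, v} \<in> edges G)"
    proof cases
      case 1
      then show ?thesis by (rule less)
    next
      case 2
      then obtain v u where "v \<in> ?B j" "u \<in> ?B i" "{v, u} \<in> edges G" and "?B j \<inter> ?B i = {}"
        using less by blast
      moreover from this have "{u, v} \<in> edges G"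
        by (simp add: insert_commute)
      ultimately show ?thesis by blast
    qed
    then show "?B i \<inter> ?B j = {}" "\<exists>u\<in>?B i. \<exists>v\<in>?B j. {u, v} \<in> edges G"
      by blast+
  next
    fix i assume "i < length Bs"
    from connected_in_if_attached[OF nth(2,1,3)[OF this] R] show "connected_in G (?B i)" .
  qed
qed

section \<open>Generalized Petersen graphs\<close>

definition gp_step :: "int \<Rightarrow> bool \<Rightarrow> int" where
  "gp_step k a = (if a then k else 1)"

text \<open>The vertices \<open>(False, i)\<close> form the outer cycle, the \<open>(True, i)\<close> the inner ones.\<close>

definition gp :: "int \<Rightarrow> int \<Rightarrow> (bool \<times> int) graph" where
  "gp p k =
     \<lparr>verts = UNIV \<times> {0..<p},
      edges = (\<lambda>(a, i). {(a, i), (a, (i + gp_step k a) mod p)}) ` (UNIV \<times> {0..<p}) \<union>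
              (\<lambda>i. {(False, i), (True, i)}) ` {0..<p}\<rparr>"

fun gp_adj :: "int \<Rightarrow> int \<Rightarrow> bool \<times> int \<Rightarrow> bool \<times> int \<Rightarrow> bool" where
  "gp_adj p k (a, i) (b, j) \<longleftrightarrow>
     (if a = b then (i + gp_step k a) mod p = j \<or> (j + gp_step k a) mod p = i else i = j)"

definition gp_map :: "int \<Rightarrow> int \<Rightarrow> int \<Rightarrow> bool \<times> int \<Rightarrow> bool \<times> int" where
  "gp_map p s t = map_prod id (\<lambda>i. (s * i + t) mod p)"

lemma gp_map_simp [simp]: "gp_map p s t (a, i) = (a, (s * i + t) mod p)"
  by (simp add: gp_map_def)

definition gp_decode :: "int \<Rightarrow> int \<Rightarrow> bool \<times> int" where
  "gp_decode p n = (if n < p then (False, n) else (True, n - p))"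

text \<open>Representatives under the dihedral group: a rotation brings one end to position 0, a
  reflection brings the other within \<open>p div 2\<close>. The combination
  \<open>(True, False)\<close> is covered by \<open>(False, True)\<close>, as edges are
  unordered.\<close>

definition gp_nonedges :: "int \<Rightarrow> int \<Rightarrow> ((bool \<times> int) \<times> (bool \<times> int)) list" where
  "gp_nonedges p k = filter (\<lambda>(u, v). u \<noteq> v \<and> \<not> gp_adj p k u v)
     [((a, 0), (b, d)). (a, b) \<leftarrow> [(False, False), (True, True), (False, True)], d \<leftarrow> [0..p div 2]]"

text \<open>The added edge is entered in one direction only; accordingly the tables list the branch
  set of \<open>u\<close> before that of \<open>v\<close>.\<close>

definition gp_certs :: "int \<Rightarrow> int \<Rightarrow> nat \<Rightarrow> int list list list \<Rightarrow> bool" where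
  "gp_certs p k r Cs \<longleftrightarrow>
     list_all2 (\<lambda>(u, v) Bs. length Bs = r \<and>
       minor_certificate (\<lambda>x y. gp_adj p k x y \<or> x = u \<and> y = v)
         (\<lambda>v. 0 \<le> snd v \<and> snd v < p) (map (map (gp_decode p)) Bs))
     (gp_nonedges p k) Cs"

text \<open>Coprimality makes the inner vertices a single cycle, on which connectivity after the
  deletion of an outer vertex relies.\<close>

locale gp_parameters =
  fixes p k :: int
  assumes p: "3 \<le> p" and k: "0 < k" "k < p" "coprime k p"
begin

lemma gp_verts: "verts (gp p k) = UNIV \<times> {0..<p}"
  by (simp add: gp_def)

lemma gp_step_bounds: "0 < gp_step k a" "gp_step k a < p"
  using p k by (auto simp: gp_step_def)

lemma gp_edge_step:
  "0 \<le> i \<Longrightarrow> i < p \<Longrightarrow> {(a, i), (a, (i + gp_step k a) mod p)} \<in> edges (gp p k)"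
  by (auto simp: gp_def intro!: UnI1 image_eqI[of _ _ "(a, i)"])

lemma gp_edge_spoke: "0 \<le> i \<Longrightarrow> i < p \<Longrightarrow> {(False, i), (True, i)} \<in> edges (gp p k)"
  by (auto simp: gp_def)

lemma gp_edges_cases:
  assumes "e \<in> edges (gp p k)"
  obtains a i where "0 \<le> i" "i < p" "e = {(a, i), (a, (i + gp_step k a) mod p)}"
  | i where "0 \<le> i" "i < p" "e = {(False, i), (True, i)}"
  using assms by (auto simp: gp_def)

lemma gp_edge_iff:
  assumes "u \<in> verts (gp p k)" "v \<in> verts (gp p k)"
  shows "{u, v} \<in> edges (gp p k) \<longleftrightarrow> gp_adj p k u v"
proof
  assume "{u, v} \<in> edges (gp p k)"
  then show "gp_adj p k u v"
    by (cases rule: gp_edges_cases) (auto simp: doubleton_eq_iff)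
next
  obtain a i b j where uv: "u = (a, i)" "v = (b, j)"
    by (cases u, cases v)
  have ij: "0 \<le> i" "i < p" "0 \<le> j" "j < p"
    using assms uv by (auto simp: gp_verts)
  assume "gp_adj p k u v"
  then consider "a = b" "(i + gp_step k a) mod p = j" | "a = b" "(j + gp_step k a) mod p = i"
    | "\<not> a" "b" "i = j" | "a" "\<not> b" "i = j"
    using uv by (auto split: if_splits)
  then show "{u, v} \<in> edges (gp p k)"
    using gp_edge_step[OF ij(1,2), of a] gp_edge_step[OF ij(3,4), of a] gp_edge_spoke[OF ij(1,2)] uv
    by cases (auto simp: insert_commute)
qed

lemma gp_shift_neq: "0 \<le> i \<Longrightarrow> i < p \<Longrightarrow> (i + gp_step k a) mod p \<noteq> i"
proof
  assume i: "0 \<le> i" "i < p" and "(i + gp_step k a) mod p = i"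
  then have "(i + gp_step k a) mod p = i mod p"
    by simp
  then have "p dvd gp_step k a"
    by (simp add: mod_eq_dvd_iff)
  then show False
    using zdvd_imp_le gp_step_bounds[of a] by fastforce
qed

lemma simple_graph_gp: "simple_graph (gp p k)"
  unfolding simple_graph_def
proof (intro conjI ballI)
  fix e assume "e \<in> edges (gp p k)"
  then have "e \<subseteq> verts (gp p k) \<and> card e = 2"
  proof (cases rule: gp_edges_cases)
    case (1 a i)
    then show ?thesis
      using gp_shift_neq[of i a] p by (auto simp: gp_verts card_insert_if)
  next
    case (2 i)
    then show ?thesis
      by (auto simp: gp_verts card_insert_if)
  qed
  then show "e \<subseteq> verts (gp p k)" "card e = 2" by simp_all
qed (simp add: gp_verts)

lemma card_verts_gp: "card (verts (gp p k)) = 2 * nat p"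
  by (simp add: gp_verts card_cartesian_product card_UNIV_bool)

lemma card_edges_gp: "card (edges (gp p k)) \<le> 3 * nat p"
proof -
  have "card (edges (gp p k)) \<le> card ((UNIV :: bool set) \<times> {0..<p}) + card {0..<p}"
    unfolding gp_def graph.simps by (intro order_trans[OF card_Un_le] add_mono card_image_le) auto
  then show ?thesis
    by (simp add: card_cartesian_product card_UNIV_bool)
qed

lemma gp_degree:
  assumes "v \<in> verts (gp p k)"
  shows "card {e \<in> edges (gp p k). v \<in> e} \<le> 3"
proof -
  obtain a i where v: "v = (a, i)" by (cases v)
  have i: "0 \<le> i" "i < p"
    using assms v by (auto simp: gp_verts)
  let ?N = "{{v, (a, (i + gp_step k a) mod p)}, {v, (a, (i - gp_step k a) mod p)}, {v, (\<not> a, i)}}"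
  have "{e \<in> edges (gp p k). v \<in> e} \<subseteq> ?N"
  proof
    fix e assume "e \<in> {e \<in> edges (gp p k). v \<in> e}"
    then have e: "e \<in> edges (gp p k)" "v \<in> e" by auto
    from e(1) show "e \<in> ?N"
    proof (cases rule: gp_edges_cases)
      case (1 b j)
      have "j = (i - gp_step k b) mod p" if "i = (j + gp_step k b) mod p"
        using 1 that by (simp add: mod_diff_left_eq)
      then show ?thesis
        using 1 e(2) v by (auto simp: insert_commute)
    next
      case (2 j)
      then show ?thesis
        using e(2) v by (auto simp: insert_commute)
    qed
  qed
  then have "card {e \<in> edges (gp p k). v \<in> e} \<le> card ?N"
    by (intro card_mono) auto
  also have "\<dots> \<le> 3"
    by (simp add: card_insert_if)
  finally show ?thesis .
qed

section \<open>Dihedral symmetries and saturation\<close>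

lemma gp_map_edge:
  assumes "s \<in> {1, -1}" "e \<in> edges (gp p k)"
  shows "gp_map p s t ` e \<in> edges (gp p k)"
  using assms(2)
proof (cases rule: gp_edges_cases)
  case (1 a i)
  let ?q = "gp_step k a"
  show ?thesis
  proof (cases "s = 1")
    case True
    have "((i + ?q) mod p + t) mod p = ((i + t) mod p + ?q) mod p"
      by (simp add: mod_simps algebra_simps)
    then show ?thesis
      using gp_edge_step[of "(i + t) mod p" a] 1 True p by simp
  next
    case False
    \<comment> \<open>A reflection reverses the cycles: the image edge steps from the image of the
      far end to that of the near end.\<close>
    have "(- ((i + ?q) mod p) + t) mod p = (t - i - ?q) mod p"
      by (simp add: mod_simps algebra_simps)
    moreover have "(- i + t) mod p = ((t - i - ?q) mod p + ?q) mod p"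
      by (simp add: mod_simps)
    ultimately show ?thesis
      using gp_edge_step[of "(t - i - ?q) mod p" a] 1 False assms(1) p by (simp add: insert_commute)
  qed
next
  case (2 i)
  then show ?thesis
    using gp_edge_spoke[of "(s * i + t) mod p"] p by simp
qed

lemma inj_on_gp_map:
  assumes "s \<in> {1, -1}"
  shows "inj_on (gp_map p s t) (verts (gp p k))"
proof (rule inj_onI)
  fix u v assume uv: "u \<in> verts (gp p k)" "v \<in> verts (gp p k)" "gp_map p s t u = gp_map p s t v"
  obtain a i b j where ab: "u = (a, i)" "v = (b, j)"
    by (cases u, cases v)
  then have "(s * i + t) mod p = (s * j + t) mod p"
    using uv by simp
  \<comment> \<open>Multiplying by \<open>s\<close> once more undoes it, as
    \<open>s * s = 1\<close>.\<close>
  then have "(s * (s * i + t - t)) mod p = (s * (s * j + t - t)) mod p"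
    by (metis mod_diff_left_eq mod_mult_right_eq)
  then have "i mod p = j mod p"
    using assms by auto
  then show "u = v"
    using uv ab by (auto simp: gp_verts)
qed

text \<open>Rotations and reflections move every nonedge to one of those listed in \<open>gp_nonedges\<close>.\<close>

lemma minor_saturated_gp:
  assumes certs: "gp_certs p k r Cs" and small: "2 * nat p < r * (r - 3)"
  shows "minor_saturated r (gp p k)"
  unfolding minor_saturated_def
proof (intro conjI ballI impI)
  show "simple_graph (gp p k)" by (rule simple_graph_gp)
  show "\<not> has_minor (gp p k) (complete_graph r)"
    using small gp_degree by (intro not_complete_minor_subcubic simple_graph_gp) (auto simp: card_verts_gp)
  have base: "has_minor (add_edge (gp p k) {u, v}) (complete_graph r)"
    if uv: "(u, v) \<in> set (gp_nonedges p k)" for u v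
  proof -
    obtain Bs where Bs: "length Bs = r" "minor_certificate (\<lambda>x y. gp_adj p k x y \<or> x = u \<and> y = v)
        (\<lambda>v. 0 \<le> snd v \<and> snd v < p) (map (map (gp_decode p)) Bs)"
      using certs uv unfolding gp_certs_def list_all2_conv_all_nth in_set_conv_nth by fastforce
    have verts: "(\<lambda>w. 0 \<le> snd w \<and> snd w < p) = (\<lambda>w. w \<in> verts (add_edge (gp p k) {u, v}))"
      by (auto simp: add_edge_def gp_verts)
    have "has_minor (add_edge (gp p k) {u, v}) (complete_graph (length (map (map (gp_decode p)) Bs)))"
    proof (rule has_complete_minor_if_certificate[OF Bs(2)[unfolded verts]])
      fix x y assume "x \<in> verts (add_edge (gp p k) {u, v})" "y \<in> verts (add_edge (gp p k) {u, v})"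
        "gp_adj p k x y \<or> x = u \<and> y = v"
      then show "{x, y} \<in> edges (add_edge (gp p k) {u, v})"
        using gp_edge_iff[of x y] by (auto simp: add_edge_def)
    qed
    then show ?thesis using Bs(1) by simp
  qed
  have sorted: "has_minor (add_edge (gp p k) {(a, i), (b, j)}) (complete_graph r)"
    if ab: "(a, b) \<in> {(False, False), (True, True), (False, True)}"
      and ij: "i \<in> {0..<p}" "j \<in> {0..<p}" "(a, i) \<noteq> (b, j)"
      and nonedge: "{(a, i), (b, j)} \<notin> edges (gp p k)" for a b i j
  proof -
    \<comment> \<open>The residues of \<open>j - i\<close> and \<open>i - j\<close> modulo
      \<open>p\<close> sum to \<open>p\<close> unless both vanish, so one of them is at most
      \<open>p div 2\<close>.\<close>
    have "\<exists>s\<in>{1, -1}. (s * (j - i)) mod p \<le> p div 2"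
    proof (cases "(j - i) mod p \<le> p div 2")
      case False
      then have "(j - i) mod p \<noteq> 0" using p by linarith
      then have "(- (j - i)) mod p = p - (j - i) mod p"
        by (simp only: zmod_zminus1_eq_if if_False)
      then have "(- 1 * (j - i)) mod p \<le> p div 2"
        using False unfolding mult_minus1 by linarith
      then show ?thesis by blast
    next
      case True
      then have "(1 * (j - i)) mod p \<le> p div 2"
        by (simp only: mult_1)
      then show ?thesis by blast
    qed
    then obtain s where s: "s \<in> {1, -1}" "(s * (j - i)) mod p \<le> p div 2" by blast
    define d where "d = (s * (j - i)) mod p"
    have d: "0 \<le> d" "d < p" "d \<le> p div 2"
      using s p by (auto simp: d_def)
    \<comment> \<open>Since \<open>s * s = 1\<close>, the map given by \<open>s\<close> and
      \<open>i\<close> sends the listed pair to the given one.\<close>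
    have "(s * d + i) mod p = (s * (s * (j - i)) + i) mod p"
      unfolding d_def by (metis mod_add_left_eq mod_mult_right_eq)
    also have "\<dots> = j"
      using s(1) ij by auto
    finally have map: "gp_map p s i (a, 0) = (a, i)" "gp_map p s i (b, d) = (b, j)"
      using ij by auto
    have "{(a, 0), (b, d)} \<notin> edges (gp p k)"
      using gp_map_edge[OF s(1), of "{(a, 0), (b, d)}" i] nonedge map by auto
    then have "\<not> gp_adj p k (a, 0) (b, d)"
      using gp_edge_iff[of "(a, 0)" "(b, d)"] d p by (auto simp: gp_verts)
    moreover have "(a, 0) \<noteq> (b, d)"
      using map ij(3) by auto
    ultimately have "((a, 0), (b, d)) \<in> set (gp_nonedges p k)"
      using ab d by (auto simp: gp_nonedges_def)
    then have "has_minor (add_edge (gp p k) {(a, 0), (b, d)}) (complete_graph r)"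
      by (rule base)
    then show ?thesis
    proof (rule has_minor_embed)
      show "inj_on (gp_map p s i) (verts (add_edge (gp p k) {(a, 0), (b, d)}))"
        using inj_on_gp_map[OF s(1)] by (simp add: add_edge_def)
      show "gp_map p s i ` verts (add_edge (gp p k) {(a, 0), (b, d)}) \<subseteq>
          verts (add_edge (gp p k) {(a, i), (b, j)})"
        using p by (auto simp: add_edge_def gp_verts)
      show "\<forall>e\<in>edges (add_edge (gp p k) {(a, 0), (b, d)}).
          gp_map p s i ` e \<in> edges (add_edge (gp p k) {(a, i), (b, j)})"
        using gp_map_edge[OF s(1)] map by (auto simp: add_edge_def)
    qed
  qed
  fix u v assume uv: "u \<in> verts (gp p k)" "v \<in> verts (gp p k)" "u \<noteq> v" "{u, v} \<notin> edges (gp p k)"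
  obtain a i b j where ab: "u = (a, i)" "v = (b, j)"
    by (cases u, cases v)
  show "has_minor (add_edge (gp p k) {u, v}) (complete_graph r)"
  proof (cases "a \<and> \<not> b")
    case True
    then show ?thesis
      using sorted[of b a j i] uv ab by (auto simp: gp_verts insert_commute)
  next
    case False
    then show ?thesis
      using sorted[of a b i j] uv ab by (auto simp: gp_verts)
  qed
qed

section \<open>Connectivity after deleting a vertex, and the gluing edge\<close>

lemma gp_cycle_cover:
  assumes "0 \<le> i" "i < p"
  shows "\<exists>m :: nat. (gp_step k a * int m) mod p = i"
proof -
  have "coprime (gp_step k a) p"
    using k by (simp add: gp_step_def)
  \<comment> \<open>Bezout's identity inverts the step modulo \<open>p\<close>: the residue of
    \<open>u * i\<close> is a number of steps leading from 0 to \<open>i\<close>.\<close>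
  then obtain u v where uv: "u * gp_step k a + v * p = 1"
    using bezout_int[of "gp_step k a" p] by auto
  have "gp_step k a * (u * i) = i + p * (- v * i)"
    using arg_cong[OF uv, of "\<lambda>w. w * i"] by (simp add: algebra_simps)
  then have "(gp_step k a * (u * i)) mod p = i"
    using assms by (metis mod_mult_self2 mod_pos_pos_trivial)
  moreover have "0 \<le> (u * i) mod p"
    using p by simp
  ultimately have "(gp_step k a * int (nat ((u * i) mod p))) mod p = i"
    by (simp add: mod_mult_right_eq)
  then show ?thesis by blast
qed

text \<open>The cycle of \<open>a\<close> survives intact, and every remaining vertex of the other
  type hangs on it by its spoke.\<close>

lemma connected_gp_minus: "connected_in (gp p k) (verts (gp p k) - {(\<not> a, 0)})"
proof (rule connected_inI[of "(a, 0)"])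
  let ?S = "verts (gp p k) - {(\<not> a, 0)}"
  let ?R = "links (gp p k) ?S"
  have multiple: "((a, 0), (a, (gp_step k a * int m) mod p)) \<in> ?R\<^sup>*" for m
  proof (induction m)
    case (Suc m)
    let ?i = "(gp_step k a * int m) mod p"
    have i: "0 \<le> ?i" "?i < p"
      using p by auto
    have eq: "(?i + gp_step k a) mod p = (gp_step k a * int (Suc m)) mod p"
      by (simp add: mod_simps algebra_simps)
    have "((a, ?i), (a, (?i + gp_step k a) mod p)) \<in> ?R"
      using gp_edge_step[OF i, of a] p by (simp add: gp_verts)
    then show ?case
      using Suc.IH unfolding eq by (rule rtrancl.rtrancl_into_rtrancl[rotated])
  qed simp
  have cycle: "((a, 0), (a, i)) \<in> ?R\<^sup>*" if i: "0 \<le> i" "i < p" for i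
  proof -
    obtain m :: nat where "(gp_step k a * int m) mod p = i"
      using gp_cycle_cover[OF i] by blast
    with multiple[of m] show ?thesis by simp
  qed
  show "((a, 0), v) \<in> ?R\<^sup>*" if v: "v \<in> ?S" for v
  proof -
    obtain b i where b: "v = (b, i)" by (cases v)
    then have i: "0 \<le> i" "i < p" "b = a \<or> b = (\<not> a) \<and> i \<noteq> 0"
      using v by (auto simp: gp_verts)
    show ?thesis
    proof (cases "b = a")
      case True
      then show ?thesis using cycle[OF i(1,2)] b by simp
    next
      case False
      then have "((a, i), (b, i)) \<in> ?R"
        using gp_edge_spoke[OF i(1,2)] i by (cases a) (auto simp: gp_verts insert_commute)
      with cycle[OF i(1,2)] show ?thesis
        unfolding b by (rule rtrancl.rtrancl_into_rtrancl)
    qed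
  qed
qed (use p in \<open>auto simp: gp_verts\<close>)

lemma gluing_block_gp:
  assumes "gp_certs p k r Cs" "2 * nat p < r * (r - 3)"
  shows "gluing_block r (gp p k) (False, 0) (True, 0)"
proof
  \<comment> \<open>For \<open>r < 3\<close> truncated subtraction makes \<open>r * (r - 3)\<close>
    zero, contradicting the size assumption.\<close>
  show "3 \<le> r"
    using assms(2) by (cases "r < 3") auto
  show "minor_saturated r (gp p k)"
    by (rule minor_saturated_gp[OF assms])
  show "{(False, 0), (True, 0)} \<in> edges (gp p k)"
    using p by (intro gp_edge_spoke) auto
  show "{u, (True, 0)} \<notin> edges (gp p k)" if "{u, (False, 0)} \<in> edges (gp p k)" for u
  proof
    assume "{u, (True, 0)} \<in> edges (gp p k)"
    then have adj: "gp_adj p k u (True, 0)" "gp_adj p k u (False, 0)" "u \<in> verts (gp p k)"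
      using that gp_edge_iff simple_graph_edgeD[OF simple_graph_gp] by blast+
    obtain a i where u: "u = (a, i)" by (cases u)
    \<comment> \<open>A common neighbour of the two ends reaches one of them by a spoke, so it has
      position 0 and is itself the other end; but no vertex is adjacent to itself.\<close>
    then have "i = 0"
      using adj by (cases a) auto
    then show False
      using adj u gp_shift_neq[of 0 a] p by (cases a) (auto simp: gp_step_def)
  qed
next
  show "connected_in (gp p k) (verts (gp p k) - {(False, 0)})"
    using connected_gp_minus[of True] by simp
  show "connected_in (gp p k) (verts (gp p k) - {(True, 0)})"
    using connected_gp_minus[of False] by simp
qed

end

text \<open>
  Found by computer search. The \<open>m\<close>-th entry lists the branch sets for the \<open>m\<close>-th pair
  in \<open>gp_nonedges\<close>.
\<close>

definition certs_8 :: "int list list list" where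
  "certs_8 = [
    [[7, 0], [10, 2], [8, 11, 3], [14, 9, 1], [15, 12, 4], [13, 6, 5]],
    [[7, 0], [11, 3], [15, 12, 4], [9, 2, 1], [14, 6, 5], [10, 13, 8]],
    [[7, 0], [12, 4], [8, 11, 3], [9, 2, 1], [14, 6, 5], [15, 13, 10]],
    [[8, 0], [12, 9], [13, 5, 4], [10, 2, 1], [14, 11, 3], [15, 7, 6]],
    [[8, 0], [10, 2], [14, 9, 1], [11, 4, 3], [13, 6, 5], [12, 15, 7]],
    [[8, 0], [15, 12], [11, 4, 3], [10, 13, 5], [9, 2, 1], [14, 7, 6]],
    [[7, 0], [12, 9], [3, 2, 1], [6, 5, 4], [14, 11, 8], [15, 13, 10]],
    [[7, 0], [10, 2], [8, 11, 3], [14, 9, 1], [15, 12, 4], [13, 6, 5]],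
    [[7, 0], [11, 3], [15, 12, 4], [9, 2, 1], [14, 6, 5], [10, 13, 8]],
    [[7, 0], [12, 4], [8, 11, 3], [9, 2, 1], [14, 6, 5], [15, 13, 10]]]"

definition certs_13 :: "int list list list" where
  "certs_13 = [
    [[11, 12, 0], [15, 3, 2], [13, 18, 5, 4], [17, 22, 14, 1], [25, 20, 7, 6], [23, 10, 9, 8], [19, 24, 21, 16]],
    [[11, 12, 0], [15, 3, 2], [13, 18, 5, 4], [17, 22, 14, 1], [25, 20, 7, 6], [23, 10, 9, 8], [19, 24, 21, 16]],
    [[11, 12, 0], [22, 17, 4], [25, 20, 8, 7], [18, 23, 10, 9], [24, 19, 6, 5], [15, 14, 2, 1], [13, 21, 16, 3]],
    [[11, 12, 0], [23, 18, 5], [16, 13, 21, 8], [24, 14, 19, 6], [4, 3, 2, 1], [25, 15, 20, 7], [17, 22, 10, 9]],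
    [[11, 12, 0], [14, 19, 6], [23, 13, 18, 5], [25, 15, 20, 7], [4, 3, 2, 1], [24, 16, 21, 8], [17, 22, 10, 9]],
    [[13, 12, 0], [17, 22, 14], [15, 3, 2, 1], [18, 6, 5, 4], [25, 20, 8, 7], [23, 11, 10, 9], [19, 24, 21, 16]],
    [[13, 12, 0], [15, 3, 2], [18, 6, 5, 4], [23, 11, 10, 9], [19, 24, 21, 16], [17, 22, 14, 1], [25, 20, 8, 7]],
    [[13, 12, 0], [16, 3, 2], [17, 22, 14, 1], [23, 18, 5, 4], [11, 24, 19, 6], [25, 15, 20, 7], [21, 10, 9, 8]],
    [[13, 12, 0], [17, 22, 14], [15, 3, 2, 1], [18, 6, 5, 4], [25, 20, 8, 7], [23, 11, 10, 9], [19, 24, 21, 16]],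
    [[13, 12, 0], [22, 19, 14], [20, 15, 2, 1], [25, 17, 5, 4], [21, 8, 7, 6], [11, 24, 16, 3], [18, 23, 10, 9]],
    [[11, 12, 0], [17, 22, 14], [13, 18, 5, 4], [24, 19, 7, 6], [16, 3, 2, 1], [21, 10, 9, 8], [25, 23, 20, 15]],
    [[11, 12, 0], [15, 3, 2], [13, 18, 5, 4], [17, 22, 14, 1], [25, 20, 7, 6], [23, 10, 9, 8], [19, 24, 21, 16]],
    [[11, 12, 0], [16, 3, 2], [24, 19, 7, 6], [17, 22, 14, 1], [13, 18, 5, 4], [21, 10, 9, 8], [25, 23, 20, 15]],
    [[11, 12, 0], [17, 22, 14], [13, 18, 5, 4], [24, 19, 7, 6], [16, 3, 2, 1], [21, 10, 9, 8], [25, 23, 20, 15]],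
    [[11, 12, 0], [23, 18, 5], [16, 13, 21, 8], [24, 14, 19, 6], [4, 3, 2, 1], [25, 15, 20, 7], [17, 22, 10, 9]],
    [[11, 12, 0], [22, 19, 14], [13, 18, 6, 5], [4, 3, 2, 1], [17, 25, 20, 7], [24, 16, 21, 8], [15, 23, 10, 9]]]"

definition certs_19 :: "int list list list" where
  "certs_19 = [
    [[16, 17, 18, 0], [33, 28, 21, 2], [37, 30, 11, 10, 9], [35, 23, 6, 5, 4], [25, 32, 15, 14, 13], [7, 8, 27, 20, 1], [36, 34, 29, 22, 3], [26, 24, 19, 31, 12]],
    [[17, 18, 1, 0], [34, 22, 4, 3], [19, 31, 24, 6, 5], [25, 37, 35, 30, 23], [26, 33, 28, 21, 2], [32, 20, 27, 8, 7], [36, 29, 11, 10, 9], [16, 15, 14, 13, 12]],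
    [[17, 18, 1, 0], [34, 22, 4, 3], [19, 31, 24, 6, 5], [25, 37, 35, 30, 23], [26, 33, 28, 21, 2], [32, 20, 27, 8, 7], [36, 29, 11, 10, 9], [16, 15, 14, 13, 12]],
    [[17, 18, 1, 0], [35, 23, 5, 4], [20, 27, 8, 7, 6], [32, 16, 15, 14, 13], [33, 9, 28, 21, 2], [36, 34, 29, 22, 3], [25, 37, 30, 11, 10], [26, 24, 19, 31, 12]],
    [[17, 18, 1, 0], [31, 24, 6, 5], [16, 15, 14, 13, 12], [36, 29, 11, 10, 9], [34, 22, 4, 3, 2], [32, 20, 27, 8, 7], [28, 21, 33, 26, 19], [25, 37, 35, 30, 23]],
    [[17, 18, 1, 0], [21, 33, 26, 7], [19, 31, 13, 12, 11], [22, 34, 16, 15, 14], [37, 28, 35, 30, 23], [24, 5, 4, 3, 2], [27, 20, 32, 25, 6], [36, 29, 10, 9, 8]],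
    [[17, 18, 1, 0], [21, 28, 9, 8], [19, 31, 12, 11, 10], [36, 24, 7, 6, 5], [27, 25, 20, 32, 13], [34, 29, 22, 3, 2], [37, 35, 30, 23, 4], [26, 33, 16, 15, 14]],
    [[17, 18, 1, 0], [21, 28, 10, 9], [37, 25, 8, 7, 6], [20, 32, 13, 12, 11], [29, 36, 31, 24, 5], [19, 26, 33, 15, 14], [27, 34, 22, 3, 2], [16, 35, 30, 23, 4]],
    [[19, 31, 13, 12], [22, 34, 27, 20], [23, 35, 16, 15, 14], [36, 24, 5, 4, 3], [33, 26, 8, 7, 6], [28, 21, 2, 1, 0], [30, 29, 11, 10, 9], [32, 25, 37, 18, 17]],
    [[19, 31, 13, 12], [21, 4, 3, 2], [28, 35, 16, 15, 14], [22, 29, 11, 10, 9], [32, 25, 37, 30, 23], [33, 26, 8, 7, 6], [34, 27, 20, 1, 0], [18, 17, 36, 24, 5]],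
    [[19, 31, 13, 12], [29, 22, 4, 3], [37, 24, 36, 18, 17], [33, 26, 7, 6, 5], [30, 11, 10, 9, 8], [28, 21, 2, 1, 0], [23, 35, 16, 15, 14], [34, 25, 32, 27, 20]],
    [[19, 31, 13, 12], [30, 23, 4, 3], [28, 11, 10, 9, 8], [35, 16, 17, 18, 0], [36, 24, 7, 6, 5], [26, 33, 21, 2, 1], [29, 22, 34, 15, 14], [37, 25, 32, 27, 20]],
    [[19, 17, 18, 0], [24, 6, 5, 4], [36, 27, 34, 29, 22], [28, 21, 3, 2, 1], [14, 33, 26, 8, 7], [31, 12, 11, 10, 9], [37, 25, 20, 32, 13], [30, 23, 35, 16, 15]],
    [[19, 31, 13, 12], [30, 37, 25, 6], [23, 35, 16, 15, 14], [7, 26, 33, 21, 2], [34, 32, 20, 27, 8], [36, 17, 18, 1, 0], [24, 22, 5, 4, 3], [29, 28, 11, 10, 9]],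
    [[19, 31, 13, 12], [27, 34, 22, 3], [35, 24, 23, 5, 4], [28, 21, 2, 1, 0], [18, 17, 16, 15, 14], [33, 26, 8, 7, 6], [36, 29, 11, 10, 9], [30, 37, 25, 32, 20]],
    [[19, 31, 13, 12], [28, 21, 2, 1], [36, 24, 5, 4, 3], [22, 34, 32, 27, 20], [30, 29, 11, 10, 9], [33, 26, 8, 7, 6], [25, 37, 17, 18, 0], [23, 35, 16, 15, 14]],
    [[16, 17, 18, 0], [25, 20, 32, 13], [35, 28, 27, 9, 8], [36, 24, 7, 6, 5], [19, 31, 12, 11, 10], [26, 33, 21, 2, 1], [37, 30, 23, 4, 3], [29, 22, 34, 15, 14]],
    [[17, 18, 1, 0], [21, 28, 10, 9], [37, 25, 8, 7, 6], [20, 32, 13, 12, 11], [29, 36, 31, 24, 5], [19, 26, 33, 15, 14], [27, 34, 22, 3, 2], [16, 35, 30, 23, 4]],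
    [[17, 18, 1, 0], [34, 22, 4, 3], [19, 31, 24, 6, 5], [25, 37, 35, 30, 23], [26, 33, 28, 21, 2], [32, 20, 27, 8, 7], [36, 29, 11, 10, 9], [16, 15, 14, 13, 12]],
    [[17, 18, 1, 0], [35, 23, 5, 4], [20, 27, 8, 7, 6], [32, 16, 15, 14, 13], [33, 9, 28, 21, 2], [36, 34, 29, 22, 3], [25, 37, 30, 11, 10], [26, 24, 19, 31, 12]],
    [[17, 18, 1, 0], [24, 31, 13, 12], [28, 21, 33, 26, 19], [36, 29, 10, 9, 8], [22, 5, 4, 3, 2], [37, 32, 25, 7, 6], [16, 35, 23, 30, 11], [20, 27, 34, 15, 14]],
    [[17, 18, 1, 0], [32, 25, 6, 5], [37, 28, 35, 30, 23], [20, 27, 10, 9, 8], [34, 16, 15, 14, 13], [29, 22, 4, 3, 2], [21, 33, 19, 26, 7], [36, 24, 31, 12, 11]],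
    [[17, 18, 1, 0], [21, 33, 26, 7], [19, 31, 13, 12, 11], [22, 34, 16, 15, 14], [37, 28, 35, 30, 23], [24, 5, 4, 3, 2], [27, 20, 32, 25, 6], [36, 29, 10, 9, 8]],
    [[17, 18, 1, 0], [27, 34, 22, 3], [37, 25, 8, 7, 6], [19, 31, 24, 5, 4], [30, 23, 35, 16, 15], [26, 33, 28, 21, 2], [36, 29, 11, 10, 9], [20, 32, 14, 13, 12]],
    [[17, 18, 1, 0], [21, 28, 10, 9], [37, 25, 8, 7, 6], [20, 32, 13, 12, 11], [29, 36, 31, 24, 5], [19, 26, 33, 15, 14], [27, 34, 22, 3, 2], [16, 35, 30, 23, 4]]]"

section \<open>Checking the certificates and the resulting bounds\<close>

lemma gp_certs_8: "gp_certs 8 3 6 certs_8"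
  by code_simp

lemma gp_certs_13: "gp_certs 13 5 7 certs_13"
  by code_simp

lemma gp_certs_19: "gp_certs 19 7 8 certs_19"
  by code_simp

text \<open>To be used with \<open>p = 8, 13, 19\<close>, where \<open>2 * nat p\<close> is 16, 26,
  38 and \<open>r * (r - 3)\<close> is 18, 28, 40.\<close>

lemma sat_bound_gp:
  fixes p k :: int
  assumes p: "3 \<le> p" and k: "0 < k" "k < p" "coprime k p"
    and certs: "gp_certs p k r Cs" and small: "2 * nat p < r * (r - 3)"
  shows "\<exists>h \<in> O(\<lambda>_. 1 :: real). \<forall>\<^sub>F n in sequentially.
    real (sat n (minor_class (complete_graph r))) \<le>
      real (3 * nat p - 1) / real (2 * nat p - 2) * real n + h n"
proof -
  interpret gp_parameters p k
    using p k by unfold_locales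
  interpret gluing_block r "gp p k" "(False, 0)" "(True, 0)"
    by (rule gluing_block_gp[OF certs small])
  have "3 \<le> nat p" using p by simp
  then show ?thesis
    using card_verts_gp card_edges_gp by (intro sat_asymptotic_bound) simp_all
qed

theorem theorem2p4:
  shows "(\<exists>h \<in> O(\<lambda>_. 1 :: real). \<forall>\<^sub>F n :: nat in sequentially.
            real (sat n (minor_class (complete_graph 6))) \<le> 23 / 14 * real n + h n)
       \<and> (\<exists>h \<in> O(\<lambda>_. 1 :: real). \<forall>\<^sub>F n :: nat in sequentially.
            real (sat n (minor_class (complete_graph 7))) \<le> 19 / 12 * real n + h n)
       \<and> (\<exists>h \<in> O(\<lambda>_. 1 :: real). \<forall>\<^sub>F n :: nat in sequentially.
            real (sat n (minor_class (complete_graph 8))) \<le> 14 / 9 * real n + h n)"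
proof (intro conjI)
  have cop: "coprime 3 (8 :: int)" "coprime 5 (13 :: int)" "coprime 7 (19 :: int)"
    by code_simp+
  show "\<exists>h \<in> O(\<lambda>_. 1 :: real). \<forall>\<^sub>F n :: nat in sequentially.
      real (sat n (minor_class (complete_graph 6))) \<le> 23 / 14 * real n + h n"
    using sat_bound_gp[OF _ _ _ cop(1) gp_certs_8] by simp
  show "\<exists>h \<in> O(\<lambda>_. 1 :: real). \<forall>\<^sub>F n :: nat in sequentially.
      real (sat n (minor_class (complete_graph 7))) \<le> 19 / 12 * real n + h n"
    using sat_bound_gp[OF _ _ _ cop(2) gp_certs_13] by simp
  show "\<exists>h \<in> O(\<lambda>_. 1 :: real). \<forall>\<^sub>F n :: nat in sequentially.
      real (sat n (minor_class (complete_graph 8))) \<le> 14 / 9 * real n + h n"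
    using sat_bound_gp[OF _ _ _ cop(3) gp_certs_19] by simp
qed

end
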